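(* Assume $\mathsf{MA}(\sigma\text{-centered})$. Then every cofinitary group of cardinality $<\mathfrak{c}$ is contained in a tight cofinitary group of cardinality $\mathfrak{c}$.
   Context: $S_\infty$ denotes the group of all permutations of $\omega$. A cofinitary group is a subgroup $\mathcal{G}\le S_\infty$ such that every non-identity element of $\mathcal{G}$ has only finitely many fixed points. $\mathsf{MA}(\sigma\text{-centered})$ is Martin's Axiom for $\sigma$-centered posets (for fewer than $\mathfrak{c}$ dense sets). A tree $T\subseteq\omega^{<\omega}$ is injective if every element of $T$ is an injective finite sequence. For an injective tree $T$ and $g\in\omega^\omega$, $g$ densely diagonalizes $T$ if for every $s\in T$ there are $t\in T$ with $s\subseteq t$ and $k\in\mathrm{dom}(t)\setminus\mathrm{dom}(s)$ with $t(k)=g(k)$. For a cofinitary group $\mathcal{G}$, $\mathcal{I}_i(\mathcal{G})$ is the set of all injective trees $T$ for which there exist $s\in T$ and a finite $\mathcal{P}_0\subseteq\mathcal{G}$ such that for all $t\in T$ with $s\subseteq t$ and all $k\in\mathrm{dom}(t)\setminus\mathrm{dom}(s)$ there is $f\in\mathcal{P}_0$ with $t(k)=f(k)$; $\mathcal{I}_i(\mathcal{G})^+$ is the set of injective trees not in $\mathcal{I}_i(\mathcal{G})$. A cofinitary group $\mathcal{G}$ is tight if for every sequence $\langle T_n : n<\omega\rangle$ of elements of $\mathcal{I}_i(\mathcal{G})^+$ there is a $g\in\mathcal{G}$ which densely diagonalizes $T_n$ for every $n<\omega$. *)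

theory Defs
  imports "HOL-Analysis.Analysis" "HOL-Algebra.Bij" "HOL-Library.Sublist"
begin

section \<open>Martin's Axiom for sigma-centered posets\<close>

text \<open>A pair \<open>(q, p) \<in> r\<close> is read as \<open>q \<le> p\<close>, i.e. \<open>q\<close> is the stronger condition.\<close>

definition sigma_centered :: "'p set \<Rightarrow> 'p rel \<Rightarrow> bool" where
  "sigma_centered P r \<longleftrightarrow>
     (\<exists>C :: nat \<Rightarrow> 'p set. P = (\<Union>n. C n) \<and>
        (\<forall>n F. F \<subseteq> C n \<and> finite F \<and> F \<noteq> {} \<longrightarrow> (\<exists>q\<in>P. \<forall>p\<in>F. (q, p) \<in> r)))"

definition dense_in_poset :: "'p set \<Rightarrow> 'p rel \<Rightarrow> 'p set \<Rightarrow> bool" where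
  "dense_in_poset P r D \<longleftrightarrow> D \<subseteq> P \<and> (\<forall>p\<in>P. \<exists>d\<in>D. (d, p) \<in> r)"

definition poset_filter :: "'p set \<Rightarrow> 'p rel \<Rightarrow> 'p set \<Rightarrow> bool" where
  "poset_filter P r F \<longleftrightarrow> F \<subseteq> P \<and> F \<noteq> {} \<and>
     (\<forall>p\<in>F. \<forall>q\<in>P. (p, q) \<in> r \<longrightarrow> q \<in> F) \<and>
     (\<forall>p\<in>F. \<forall>q\<in>F. \<exists>s\<in>F. (s, p) \<in> r \<and> (s, q) \<in> r)"

definition meets_dense_families :: "'p set \<Rightarrow> 'p rel \<Rightarrow> bool" where
  "meets_dense_families P r \<longleftrightarrow>
     (\<forall>\<D>. \<D> \<prec> (UNIV :: real set) \<and> (\<forall>D\<in>\<D>. dense_in_poset P r D) \<longrightarrow>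
        (\<exists>F. poset_filter P r F \<and> (\<forall>D\<in>\<D>. F \<inter> D \<noteq> {})))"

text \<open>
  A formula cannot quantify over all types, so the axiom is stated for the posets whose
  underlying set is a set of reals, i.e. up to isomorphism for all posets of size at most
  continuum. Theorem \<open>MA_sigma_centeredD\<close> below shows that nothing is lost: the axiom
  then holds for posets (indeed preorders) on an arbitrary type.
\<close>

definition MA_sigma_centered :: bool where
  "MA_sigma_centered \<longleftrightarrow>
     (\<forall>(P :: real set) r. partial_order_on P r \<and> P \<noteq> {} \<and> sigma_centered P r \<longrightarrow>
        meets_dense_families P r)"

lemma lepoll_iff_ordLeq: "A \<lesssim> B \<longleftrightarrow> ordLeq3 (card_of A) (card_of B)"
  by (metis card_of_ordLeq lepoll_def)

lemma UN_lepoll_real: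
  fixes A :: "nat \<Rightarrow> 'a set"
  assumes "\<And>n. A n \<lesssim> (UNIV :: real set)"
  shows "(\<Union>n. A n) \<lesssim> (UNIV :: real set)"
proof -
  have inf: "infinite (UNIV :: real set)"
    by (rule infinite_UNIV_char_0)
  then have "(UNIV :: nat set) \<lesssim> (UNIV :: real set)"
    by (simp add: infinite_le_lepoll)
  then show ?thesis
    using card_of_UNION_ordLeq_infinite[OF inf] assms
    unfolding lepoll_iff_ordLeq by blast
qed

lemma lists_of_lepoll_real:
  fixes X :: "'a set"
  assumes "X \<lesssim> (UNIV :: real set)"
  shows "lists X \<lesssim> (UNIV :: real set)"
proof -
  let ?L = "\<lambda>m. {xs \<in> lists X. length xs = m}"
  have inf: "infinite (UNIV :: real set)"
    by (rule infinite_UNIV_char_0)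
  have L: "?L m \<lesssim> (UNIV :: real set)" for m
  proof (induction m)
    case 0
    have "?L 0 = {[]}" by auto
    then show ?case by (simp add: finite_lepoll_infinite inf)
  next
    case (Suc m)
    have "?L (Suc m) \<subseteq> (\<lambda>(x, xs). x # xs) ` (X \<times> ?L m)"
    proof
      fix ys assume ys: "ys \<in> ?L (Suc m)"
      then obtain x xs where "ys = x # xs"
        by (cases ys) auto
      with ys show "ys \<in> (\<lambda>(x, xs). x # xs) ` (X \<times> ?L m)"
        by (auto intro!: image_eqI[of _ _ "(x, xs)"])
    qed
    then have "?L (Suc m) \<lesssim> X \<times> ?L m"
      by (rule subset_image_lepoll)
    also have "\<dots> \<lesssim> (UNIV :: real set) \<times> (UNIV :: real set)"
      using assms Suc.IH by (rule times_lepoll_mono)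
    also have "\<dots> \<lesssim> (UNIV :: real set)"
      using card_of_Times_same_infinite[OF inf] eqpoll_iff_card_of_ordIso eqpoll_imp_lepoll
      by blast
    finally show ?case .
  qed
  have "lists X = (\<Union>m. ?L m)" by auto
  moreover have "(\<Union>m. ?L m) \<lesssim> (UNIV :: real set)"
    using L by (rule UN_lepoll_real)
  ultimately show ?thesis by simp
qed

text \<open>
  A Loewenheim-Skolem argument: close a point of the preorder under choices from the dense
  sets and of lower bounds of finite sets, always choosing the same representative of a class
  of equivalent conditions. The result is a partial order of size at most continuum.
\<close>

theorem MA_sigma_centeredD:
  fixes P :: "'p set"
  assumes MA: MA_sigma_centered
    and pre: "preorder_on P r" and ne: "P \<noteq> {}" and sc: "sigma_centered P r"
  shows "meets_dense_families P r"
  unfolding meets_dense_families_def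
proof (intro allI impI, elim conjE)
  fix \<D> :: "'p set set"
  assume small: "\<D> \<prec> (UNIV :: real set)" and dn: "\<forall>D\<in>\<D>. dense_in_poset P r D"
  have inf: "infinite (UNIV :: real set)"
    by (rule infinite_UNIV_char_0)
  have rfl: "x \<in> P \<Longrightarrow> (x, x) \<in> r" for x
    using pre by (auto simp: preorder_on_def refl_on_def)
  have rP: "(x, y) \<in> r \<Longrightarrow> x \<in> P \<and> y \<in> P" for x y
    using pre by (auto simp: preorder_on_def)
  have tr: "(x, y) \<in> r \<Longrightarrow> (y, z) \<in> r \<Longrightarrow> (x, z) \<in> r" for x y z
    using pre by (meson preorder_on_def transD)
  obtain C :: "nat \<Rightarrow> 'p set" where C1: "P = (\<Union>n. C n)" and
    C2: "\<forall>n F. F \<subseteq> C n \<and> finite F \<and> F \<noteq> {} \<longrightarrow> (\<exists>q\<in>P. \<forall>p\<in>F. (q, p) \<in> r)"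
    using sc[unfolded sigma_centered_def] by (elim exE conjE)
  obtain p0 where p0: "p0 \<in> P" using ne by blast

  define rep where "rep x = (SOME y. (x, y) \<in> r \<and> (y, x) \<in> r)" for x
  have rep: "(x, rep x) \<in> r \<and> (rep x, x) \<in> r" if "x \<in> P" for x
    unfolding rep_def using rfl[OF that] by (rule_tac someI[of _ x]) simp
  have rep_eq: "rep x = rep y" if "(x, y) \<in> r" "(y, x) \<in> r" for x y
  proof -
    have "(\<lambda>z. (x, z) \<in> r \<and> (z, x) \<in> r) = (\<lambda>z. (y, z) \<in> r \<and> (z, y) \<in> r)"
      using that tr by blast
    then show ?thesis unfolding rep_def by simp
  qed
  define below where "below D x = (SOME y. y \<in> D \<and> (y, x) \<in> r)" for D x
  have below: "below D x \<in> D \<and> (below D x, x) \<in> r" if "D \<in> \<D>" "x \<in> P" for D x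
    unfolding below_def using dn that unfolding dense_in_poset_def by (rule_tac someI_ex) blast
  define lb where "lb F = (if \<exists>q\<in>P. \<forall>p\<in>F. (q, p) \<in> r then SOME q. q \<in> P \<and> (\<forall>p\<in>F. (q, p) \<in> r) else p0)"
    for F
  have lb_some: "lb F \<in> P \<and> (\<forall>p\<in>F. (lb F, p) \<in> r)" if "\<exists>q\<in>P. \<forall>p\<in>F. (q, p) \<in> r" for F
  proof -
    have "\<exists>q. q \<in> P \<and> (\<forall>p\<in>F. (q, p) \<in> r)" using that by blast
    from someI_ex[OF this] show ?thesis unfolding lb_def using that by simp
  qed
  have lbP: "lb F \<in> P" for F
  proof (cases "\<exists>q\<in>P. \<forall>p\<in>F. (q, p) \<in> r")
    case False
    then show ?thesis unfolding lb_def using p0 by (simp only: if_False)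
  qed (use lb_some in blast)
  have lb: "(lb F, p) \<in> r" if "\<exists>q\<in>P. \<forall>p\<in>F. (q, p) \<in> r" "p \<in> F" for F p
    using lb_some[OF that(1)] that(2) by blast

  define step where
    "step X = X \<union> (\<lambda>(D, x). rep (below D x)) ` (\<D> \<times> X) \<union> (\<lambda>xs. rep (lb (set xs))) ` lists X" for X
  define Q where "Q n = (step ^^ n) {rep p0}" for n
  define U where "U = (\<Union>n. Q n)"
  have Q0: "Q 0 = {rep p0}" and QS: "Q (Suc n) = step (Q n)" for n
    by (simp_all add: Q_def)
  have Qr: "Q n \<subseteq> rep ` P" for n
  proof (induction n)
    case 0 then show ?case using p0 by (simp add: Q0)
  next
    case (Suc n)
    have "below D x \<in> P" if "D \<in> \<D>" "x \<in> Q n" for D x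
      using that Suc.IH below rep rP by (metis image_iff subsetD)
    then show ?case using Suc.IH lbP by (auto simp: QS step_def)
  qed
  have "rep ` P \<subseteq> P" using rep rP by blast
  then have UP: "U \<subseteq> P" using Qr unfolding U_def by blast
  have Ur: "rep x = x" if x: "x \<in> U" for x
  proof -
    obtain y where y: "y \<in> P" "x = rep y" using x Qr unfolding U_def by blast
    show ?thesis using rep_eq[of "rep y" y] rep[OF y(1)] y(2) by simp
  qed
  have Qmono: "incseq Q"
    by (rule incseq_SucI) (auto simp: QS step_def)
  have Qcard: "Q n \<lesssim> (UNIV :: real set)" for n
  proof (induction n)
    case 0 then show ?case unfolding Q0 by (intro finite_lepoll_infinite inf finite.intros)
  next
    case (Suc n)
    have un: "A \<union> B \<lesssim> (UNIV :: real set)" if "A \<lesssim> (UNIV :: real set)" "B \<lesssim> (UNIV :: real set)"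
      for A B :: "'p set"
    proof -
      have "A \<union> B = (\<Union>n :: nat. if n = 0 then A else B)" by (auto split: if_splits)
      moreover have "(\<Union>n :: nat. if n = 0 then A else B) \<lesssim> (UNIV :: real set)"
        by (rule UN_lepoll_real) (use that in simp)
      ultimately show ?thesis by simp
    qed
    have "\<D> \<times> Q n \<lesssim> (UNIV :: real set) \<times> (UNIV :: real set)"
      using lesspoll_imp_lepoll[OF small] Suc.IH by (rule times_lepoll_mono)
    also have "\<dots> \<lesssim> (UNIV :: real set)"
      using card_of_Times_same_infinite[OF inf] eqpoll_iff_card_of_ordIso eqpoll_imp_lepoll
      by blast
    finally have "(\<lambda>(D, x). rep (below D x)) ` (\<D> \<times> Q n) \<lesssim> (UNIV :: real set)"
      using image_lepoll lepoll_trans by blast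
    moreover have "(\<lambda>xs. rep (lb (set xs))) ` lists (Q n) \<lesssim> (UNIV :: real set)"
      using lists_of_lepoll_real[OF Suc.IH] image_lepoll lepoll_trans by blast
    ultimately show ?case
      unfolding QS step_def using Suc.IH by (intro un)
  qed
  have "U \<lesssim> (UNIV :: real set)"
    unfolding U_def using Qcard by (rule UN_lepoll_real)
  then obtain j :: "'p \<Rightarrow> real" where j: "inj_on j U"
    unfolding lepoll_def by blast
  have jeq: "j x = j y \<longleftrightarrow> x = y" if "x \<in> U" "y \<in> U" for x y
    using j that by (meson inj_onD)

  have U_below: "rep (below D x) \<in> U" if "D \<in> \<D>" "x \<in> U" for D x
  proof -
    obtain n where "x \<in> Q n" using \<open>x \<in> U\<close> unfolding U_def by blast
    then have "rep (below D x) \<in> Q (Suc n)" using that by (force simp: QS step_def)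
    then show ?thesis unfolding U_def by blast
  qed
  have U_lb: "rep (lb F) \<in> U" if F: "finite F" "F \<subseteq> U" for F
  proof -
    have "\<exists>n. F \<subseteq> Q n"
      using F
    proof (induction F)
      case (insert x F)
      then obtain n m where "F \<subseteq> Q n" "x \<in> Q m" unfolding U_def by blast
      then have "insert x F \<subseteq> Q (max n m)"
        using Qmono by (meson insert_subset monoD max.cobounded1 max.cobounded2 order_trans subsetD)
      then show ?case by blast
    qed simp
    then obtain n where n: "F \<subseteq> Q n" by blast
    obtain xs where xs: "set xs = F" using F(1) finite_list by blast
    with n have "xs \<in> lists (Q n)" by auto
    then have "rep (lb F) \<in> Q (Suc n)" using xs by (auto simp: QS step_def)
    then show ?thesis unfolding U_def by blast
  qed

  define P' where "P' = j ` U"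
  define r' where "r' = {(j x, j y) | x y. x \<in> U \<and> y \<in> U \<and> (x, y) \<in> r}"
  define tr' where "tr' D = j ` {x \<in> U. \<exists>d\<in>D. (x, d) \<in> r}" for D
  have r': "(j x, j y) \<in> r' \<longleftrightarrow> (x, y) \<in> r" if "x \<in> U" "y \<in> U" for x y
    using that jeq unfolding r'_def by blast
  have "P' \<noteq> {}" unfolding P'_def U_def using Q0 by blast
  moreover have "partial_order_on P' r'"
    unfolding partial_order_on_def preorder_on_def
  proof (intro conjI)
    show "r' \<subseteq> P' \<times> P'" unfolding r'_def P'_def by blast
    show "refl_on P' r'" using UP rfl r' by (auto simp: refl_on_def P'_def)
    show "trans r'"
    proof (rule transI)
      fix a b c assume ab: "(a, b) \<in> r'" and bc: "(b, c) \<in> r'"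
      obtain x y where 1: "a = j x" "b = j y" "x \<in> U" "y \<in> U" "(x, y) \<in> r"
        using ab unfolding r'_def by blast
      obtain y' z where 2: "b = j y'" "c = j z" "y' \<in> U" "z \<in> U" "(y', z) \<in> r"
        using bc unfolding r'_def by blast
      have "y' = y" using 1 2 jeq by metis
      then show "(a, c) \<in> r'" using 1 2 r' tr by metis
    qed
    show "antisym r'"
    proof (rule antisymI)
      fix a b assume ab: "(a, b) \<in> r'" and ba: "(b, a) \<in> r'"
      obtain x y where 1: "a = j x" "b = j y" "x \<in> U" "y \<in> U" "(x, y) \<in> r"
        using ab unfolding r'_def by blast
      have "(y, x) \<in> r" using ba 1 r' by metis
      then have "x = y" using rep_eq 1 Ur by metis
      then show "a = b" using 1 by simp
    qed
  qed
  moreover have "sigma_centered P' r'"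
    unfolding sigma_centered_def
  proof (intro exI[of _ "\<lambda>n. j ` (C n \<inter> U)"] conjI allI impI)
    show "P' = (\<Union>n. j ` (C n \<inter> U))" using UP C1 unfolding P'_def by blast
    fix n F assume "F \<subseteq> j ` (C n \<inter> U) \<and> finite F \<and> F \<noteq> {}"
    then obtain G where G: "G \<subseteq> C n \<inter> U" "finite G" "F = j ` G" "G \<noteq> {}"
      by (metis finite_subset_image image_is_empty)
    then have ex: "\<exists>q\<in>P. \<forall>p\<in>G. (q, p) \<in> r" using C2 by (metis le_inf_iff)
    have "(rep (lb G), p) \<in> r" if "p \<in> G" for p
      using lb[OF ex that] rep[OF lbP[of G]] tr by blast
    moreover have "rep (lb G) \<in> U" using U_lb G by blast
    ultimately show "\<exists>q\<in>P'. \<forall>p\<in>F. (q, p) \<in> r'"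
      using G r' unfolding P'_def by blast
  qed
  ultimately have M: "meets_dense_families P' r'"
    using MA unfolding MA_sigma_centered_def by blast
  have "tr' ` \<D> \<prec> (UNIV :: real set)"
    using image_lepoll small by (rule lesspoll_trans1)
  moreover have "\<forall>D\<in>tr' ` \<D>. dense_in_poset P' r' D"
  proof
    fix E assume "E \<in> tr' ` \<D>"
    then obtain D where D: "D \<in> \<D>" "E = tr' D" by blast
    show "dense_in_poset P' r' E"
      unfolding dense_in_poset_def
    proof (intro conjI ballI)
      show "E \<subseteq> P'" unfolding D(2) tr'_def P'_def by blast
      fix a assume "a \<in> P'"
      then obtain x where x: "x \<in> U" "a = j x" unfolding P'_def by blast
      have b: "below D x \<in> D" "(below D x, x) \<in> r" using below[OF D(1)] x UP by blast+
      then have "(rep (below D x), below D x) \<in> r" using rep rP by blast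
      moreover from this have "(rep (below D x), x) \<in> r" using b tr by blast
      moreover have "rep (below D x) \<in> U" using U_below D x by blast
      ultimately show "\<exists>d\<in>E. (d, a) \<in> r'"
        using b x r' unfolding D(2) tr'_def by blast
    qed
  qed
  ultimately have "\<exists>F'. poset_filter P' r' F' \<and> (\<forall>E\<in>tr' ` \<D>. F' \<inter> E \<noteq> {})"
    by (intro M[unfolded meets_dense_families_def, rule_format] conjI) simp_all
  then obtain F' where F': "poset_filter P' r' F'" "\<forall>E\<in>tr' ` \<D>. F' \<inter> E \<noteq> {}"
    by (elim exE conjE)
  define F where "F = {p \<in> P. \<exists>x\<in>U. j x \<in> F' \<and> (x, p) \<in> r}"
  have "F \<noteq> {}"
    using F'(1) UP rfl unfolding poset_filter_def F_def P'_def by blast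
  moreover have "\<exists>s\<in>F. (s, p) \<in> r \<and> (s, q) \<in> r" if pq: "p \<in> F" "q \<in> F" for p q
  proof -
    obtain x y where xy: "x \<in> U" "j x \<in> F'" "(x, p) \<in> r" "y \<in> U" "j y \<in> F'" "(y, q) \<in> r"
      using pq unfolding F_def by blast
    then obtain a where a: "a \<in> F'" "(a, j x) \<in> r'" "(a, j y) \<in> r'"
      using F'(1) unfolding poset_filter_def by blast
    then obtain z where z: "z \<in> U" "a = j z"
      using F'(1) unfolding poset_filter_def P'_def by blast
    then have "(z, x) \<in> r" "(z, y) \<in> r" using a xy r' by blast+
    moreover have "z \<in> F" using z a UP rfl unfolding F_def by blast
    ultimately show ?thesis using xy tr by blast
  qed
  moreover have "F \<subseteq> P" "\<forall>p\<in>F. \<forall>q\<in>P. (p, q) \<in> r \<longrightarrow> q \<in> F"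
    unfolding F_def using tr by blast+
  ultimately have "poset_filter P r F" unfolding poset_filter_def by blast
  moreover have "F \<inter> D \<noteq> {}" if D: "D \<in> \<D>" for D
  proof -
    have "F' \<inter> tr' D \<noteq> {}" using F'(2) D by (rule_tac bspec) simp_all
    then obtain a where "a \<in> F'" "a \<in> tr' D" by blast
    then obtain x d where "x \<in> U" "j x \<in> F'" "d \<in> D" "(x, d) \<in> r" unfolding tr'_def by blast
    then show ?thesis using rP unfolding F_def by blast
  qed
  ultimately show "\<exists>F. poset_filter P r F \<and> (\<forall>D\<in>\<D>. F \<inter> D \<noteq> {})" by blast
qed


section \<open>Tight cofinitary groups\<close>

text \<open>Since \<open>extensional UNIV = UNIV\<close>, the carrier of \<open>BijGroup (UNIV :: nat set)\<close> consists of
  all permutations of the natural numbers, with composition as multiplication.\<close>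

definition cofinitary_group :: "(nat \<Rightarrow> nat) set \<Rightarrow> bool" where
  "cofinitary_group G \<longleftrightarrow> subgroup G (BijGroup UNIV) \<and>
     (\<forall>g\<in>G. g \<noteq> \<one>\<^bsub>BijGroup UNIV\<^esub> \<longrightarrow> finite {n. g n = n})"

text \<open>Finite sequences are lists: \<open>dom t = {..<length t}\<close>, and \<open>s \<subseteq> t\<close> is \<open>prefix s t\<close>.\<close>

definition injective_tree :: "nat list set \<Rightarrow> bool" where
  "injective_tree T \<longleftrightarrow> (\<forall>t\<in>T. \<forall>s. prefix s t \<longrightarrow> s \<in> T) \<and> (\<forall>t\<in>T. distinct t)"

definition densely_diagonalizes :: "(nat \<Rightarrow> nat) \<Rightarrow> nat list set \<Rightarrow> bool" where
  "densely_diagonalizes g T \<longleftrightarrow>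
     (\<forall>s\<in>T. \<exists>t\<in>T. prefix s t \<and> (\<exists>k\<in>{..<length t} - {..<length s}. t ! k = g k))"

definition tree_ideal :: "(nat \<Rightarrow> nat) set \<Rightarrow> nat list set set" where
  "tree_ideal G = {T. injective_tree T \<and>
     (\<exists>s\<in>T. \<exists>P\<^sub>0. finite P\<^sub>0 \<and> P\<^sub>0 \<subseteq> G \<and>
        (\<forall>t\<in>T. prefix s t \<longrightarrow>
           (\<forall>k\<in>{..<length t} - {..<length s}. \<exists>f\<in>P\<^sub>0. t ! k = f k)))}"

definition tree_ideal_positive :: "(nat \<Rightarrow> nat) set \<Rightarrow> nat list set set" where
  "tree_ideal_positive G = {T. injective_tree T \<and> T \<notin> tree_ideal G}"

definition tight_cofinitary_group :: "(nat \<Rightarrow> nat) set \<Rightarrow> bool" where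
  "tight_cofinitary_group G \<longleftrightarrow> cofinitary_group G \<and>
     (\<forall>T :: nat \<Rightarrow> nat list set. (\<forall>n. T n \<in> tree_ideal_positive G) \<longrightarrow>
        (\<exists>g\<in>G. \<forall>n. densely_diagonalizes g (T n)))"

end

theory Submission
  imports Defs "HOL-Algebra.Generated_Groups"
begin

text \<open>
  Conditions \<open>(s, A)\<close> consist of a finite partial injection \<open>s\<close> and a finite \<open>A \<subseteq> G\<close>, with the
  promise that extending \<open>s\<close> creates no new trail, and hence no new fixed point, of a cyclically
  reduced word in one letter with coefficients from \<open>A\<close>. Adding a pair \<open>(n, m)\<close> keeps the promise
  as soon as \<open>m\<close> avoids a finite set and the finitely many values \<open>a n\<close> for \<open>a\<close> or its inverse in
  \<open>A\<close>. Positivity of a tree is just what provides such pairs \<open>(k, t(k))\<close> along its nodes \<open>t\<close>, so a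
  filter for fewer than continuum many dense sets yields a permutation \<open>g\<close> which densely
  diagonalizes countably many positive trees. Since the promise does not mention the length of
  words, one dense set per element of \<open>G\<close> suffices. Every element of the group generated by \<open>G\<close>
  and \<open>g\<close> is conjugate to an element of \<open>G\<close> or to a cyclically reduced word, so this group is
  cofinitary. Iterating along all sequences of trees, in a well-order of type continuum, gives the
  theorem, since a tree that is positive for a group is positive for its subgroups.
\<close>

section \<open>Trails of reduced words\<close>

definition edge :: "('a \<times> 'a) set \<Rightarrow> bool \<Rightarrow> 'a \<Rightarrow> 'a \<Rightarrow> bool" where
  "edge s e x y \<longleftrightarrow> (if e then (x, y) \<in> s else (y, x) \<in> s)"

text \<open>A bi-infinite word is given by coefficients \<open>b\<close> and exponents \<open>e\<close> (\<open>True\<close> for \<open>1\<close>,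
  \<open>False\<close> for \<open>-1\<close>), and \<open>q\<close> is a bi-infinite orbit of points under it. A fixed point of a
  cyclic word is a periodic trail; periodicity plays no role in the combinatorics.\<close>

definition trail :: "('a \<times> 'a) set \<Rightarrow> (int \<Rightarrow> 'a \<Rightarrow> 'a) \<Rightarrow> (int \<Rightarrow> bool) \<Rightarrow> (int \<Rightarrow> 'a) \<Rightarrow> bool" where
  "trail s b e q \<longleftrightarrow> (\<forall>i. edge s (e i) (b i (q (i + 1))) (q i))"

text \<open>A trail follows the formal word \<open>... g^(e i) b_i g^(e (i+1)) b_(i+1) ...\<close>,
  so \<open>b i\<close> is the coefficient between two neighbouring powers, and what is excluded is
  a cancellation of \<open>g\<close> against its inverse.\<close>

definition reduced_word :: "(int \<Rightarrow> 'a \<Rightarrow> 'a) \<Rightarrow> (int \<Rightarrow> bool) \<Rightarrow> bool" where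
  "reduced_word b e \<longleftrightarrow> (\<forall>i. e i \<noteq> e (i + 1) \<longrightarrow> b i \<noteq> id)"

definition no_new_trails :: "('a \<Rightarrow> 'a) set \<Rightarrow> ('a \<times> 'a) set \<Rightarrow> ('a \<times> 'a) set \<Rightarrow> bool" where
  "no_new_trails A s t \<longleftrightarrow>
     (\<forall>b e q. range b \<subseteq> A \<and> reduced_word b e \<and> trail t b e q \<longrightarrow> trail s b e q)"

lemma no_new_trails_refl: "no_new_trails A s s"
  by (simp add: no_new_trails_def)

lemma no_new_trails_trans:
  "no_new_trails A s t \<Longrightarrow> no_new_trails B t u \<Longrightarrow> A \<subseteq> B \<Longrightarrow> no_new_trails A s u"
  unfolding no_new_trails_def by (meson subset_trans)

lemma edge_converse: "edge (s\<inverse>) e x y \<longleftrightarrow> edge s (\<not> e) x y"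
  by (simp add: edge_def)

lemma trail_converse: "trail (s\<inverse>) b e q \<longleftrightarrow> trail s b (\<lambda>i. \<not> e i) q"
  by (simp add: trail_def edge_converse)

text \<open>Inverting the partial injection flips all exponents, which keeps a word reduced. This
  symmetry later turns extensions of the domain into extensions of the range.\<close>

lemma no_new_trails_converse:
  assumes "no_new_trails A (s\<inverse>) (t\<inverse>)"
  shows "no_new_trails A s t"
  unfolding no_new_trails_def
proof (intro allI impI, elim conjE)
  fix b e q assume b: "range b \<subseteq> A" and r: "reduced_word b e" and t: "trail t b e q"
  have "reduced_word b (\<lambda>i. \<not> e i)" using r by (simp add: reduced_word_def)
  moreover have "trail (t\<inverse>) b (\<lambda>i. \<not> e i) q" using t by (simp add: trail_converse)
  ultimately have "trail (s\<inverse>) b (\<lambda>i. \<not> e i) q"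
    using assms b unfolding no_new_trails_def by blast
  then show "trail s b e q" by (simp add: trail_converse)
qed

text \<open>A trail through the new pair \<open>(n, m)\<close> would have to leave \<open>m\<close> at its other side through a
  coefficient \<open>a\<close>, but \<open>a m\<close> is not an end point of any pair, unless \<open>a = id\<close> and the trail
  goes back to \<open>n\<close>, which reducedness forbids.\<close>

lemma no_new_trails_insert:
  assumes bij: "\<And>a. a \<in> A \<Longrightarrow> bij a"
    and fresh: "\<And>a. a \<in> A \<union> inv_into UNIV ` A \<Longrightarrow> a m \<notin> insert n (Domain s \<union> Range s)"
    and fixp: "\<And>a. a \<in> A \<Longrightarrow> a m = m \<Longrightarrow> a = id"
  shows "no_new_trails A s (insert (n, m) s)"
  unfolding no_new_trails_def
proof (intro allI impI, elim conjE)
  fix b e q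
  assume b: "range b \<subseteq> A" and r: "reduced_word b e" and t: "trail (insert (n, m) s) b e q"
  have bA: "b i \<in> A" for i using b by blast
  have E: "edge (insert (n, m) s) (e i) (b i (q (i + 1))) (q i)" for i
    using t by (simp add: trail_def)
  show "trail s b e q"
    unfolding trail_def
  proof (rule allI, rule ccontr)
    fix i assume new: "\<not> edge s (e i) (b i (q (i + 1))) (q i)"
    show False
    proof (cases "e i")
      case True
      then have qi: "q i = m" using new E[of i] by (auto simp: edge_def)
      have "b (i - 1) m \<notin> insert n (Domain s \<union> Range s)" using fresh bA by blast
      then have "\<not> e (i - 1) \<and> b (i - 1) m = m"
        using E[of "i - 1"] qi by (auto simp: edge_def split: if_splits)
      then show False using r True fixp[OF bA] by (metis diff_add_cancel reduced_word_def)
    next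
      \<comment> \<open>A backward step meets its neighbour at the preimage of \<open>m\<close>
        under a coefficient, which is why \<open>fresh\<close> also covers inverses.\<close>
      case False
      then have qi: "b i (q (i + 1)) = m" using new E[of i] by (auto simp: edge_def)
      then have q1: "q (i + 1) = inv_into UNIV (b i) m"
        using bij[OF bA] by (metis bij_inv_eq_iff)
      have "q (i + 1) \<notin> insert n (Domain s \<union> Range s)" unfolding q1 using fresh bA by blast
      then have "e (i + 1) \<and> q (i + 1) = m"
        using E[of "i + 1"] by (auto simp: edge_def split: if_splits)
      then show False using r False fixp[OF bA] qi by (metis reduced_word_def)
    qed
  qed
qed

text \<open>\<open>V\<close> collects the support of \<open>s\<close>, the points sent into it by a
  coefficient or its inverse, and the fixed points of nontrivial coefficients. It does not depend on
  \<open>n\<close>, so it can be fixed before a tree supplies both coordinates of a pair.\<close>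

lemma finite_not_fresh:
  assumes A: "finite A" "\<And>a. a \<in> A \<Longrightarrow> bij a"
    and fixp: "\<And>a. a \<in> A \<Longrightarrow> a \<noteq> id \<Longrightarrow> finite {x. a x = x}"
    and s: "finite s"
  shows "\<exists>V. finite V \<and> (\<forall>n m. m \<notin> V \<and> (\<forall>a\<in>A \<union> inv_into UNIV ` A. m \<noteq> a n) \<longrightarrow>
     m \<notin> Domain s \<union> Range s \<and> no_new_trails A s (insert (n, m) s))"
proof -
  let ?D = "Domain s \<union> Range s"
  define V where "V = ?D \<union> (\<Union>a\<in>A \<union> inv_into UNIV ` A. a -` ?D) \<union> (\<Union>a\<in>A - {id}. {x. a x = x})"
  have D: "finite ?D" using s by (simp add: finite_Domain finite_Range)
  have bij': "bij a" if "a \<in> A \<union> inv_into UNIV ` A" for a using that A(2) bij_imp_bij_inv by blast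
  have V: "finite V"
    unfolding V_def using A(1) D fixp bij' by (auto intro!: finite_vimageI dest: bij_is_inj)
  have "m \<notin> ?D \<and> no_new_trails A s (insert (n, m) s)"
    if m: "m \<notin> V" "\<forall>a\<in>A \<union> inv_into UNIV ` A. m \<noteq> a n" for n m
  proof
    show "m \<notin> ?D" using m by (simp add: V_def)
    show "no_new_trails A s (insert (n, m) s)"
    proof (rule no_new_trails_insert)
      show "a = id" if "a \<in> A" "a m = m" for a using that m by (auto simp: V_def)
      fix a assume a: "a \<in> A \<union> inv_into UNIV ` A"
      \<comment> \<open>The family is closed under inverses, so \<open>a m = n\<close> would make
        \<open>m\<close> one of the excluded values at \<open>n\<close>.\<close>
      have "inv_into UNIV a \<in> A \<union> inv_into UNIV ` A" using a A(2) by (auto simp: inv_inv_eq)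
      then have "a m \<noteq> n" using m(2) bij'[OF a] by (metis bij_inv_eq_iff)
      moreover have "a m \<notin> ?D" using m(1) a unfolding V_def by blast
      ultimately show "a m \<notin> insert n ?D" by blast
    qed (rule A(2))
  qed
  then show ?thesis using V by metis
qed

section \<open>Words in a group and one further permutation\<close>

definition letter :: "('a \<Rightarrow> 'a) \<Rightarrow> ('a \<Rightarrow> 'a) \<times> bool \<Rightarrow> 'a \<Rightarrow> 'a" where
  "letter g l = fst l \<circ> (if snd l then g else inv_into UNIV g)"

definition word :: "('a \<Rightarrow> 'a) \<Rightarrow> (('a \<Rightarrow> 'a) \<times> bool) list \<Rightarrow> 'a \<Rightarrow> 'a" where
  "word g w = foldr (\<lambda>l h. letter g l \<circ> h) w id"

lemma word_Nil [simp]: "word g [] = id"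
  and word_Cons [simp]: "word g (l # w) = letter g l \<circ> word g w"
  by (simp_all add: word_def)

lemma word_append: "word g (v @ w) = word g v \<circ> word g w"
  by (induction v) (simp_all add: comp_assoc)

text \<open>A letter carries its coefficient on the left, so the coefficient between the powers in
  letters \<open>i\<close> and \<open>i + 1\<close> belongs to the latter. The successor is cyclic
  because conjugation makes the last letter a neighbour of the first; a single letter always
  qualifies.\<close>

definition cyclically_reduced :: "(('a \<Rightarrow> 'a) \<times> bool) list \<Rightarrow> bool" where
  "cyclically_reduced w \<longleftrightarrow> (\<forall>i<length w.
     snd (w ! i) \<noteq> snd (w ! (Suc i mod length w)) \<longrightarrow> fst (w ! (Suc i mod length w)) \<noteq> id)"

lemma bij_letter: "bij g \<Longrightarrow> bij (fst l) \<Longrightarrow> bij (letter g l)"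
  unfolding letter_def by (simp add: bij_comp bij_imp_bij_inv)

lemma bij_word: "bij g \<Longrightarrow> \<forall>l\<in>set w. bij (fst l) \<Longrightarrow> bij (word g w)"
  by (induction w) (simp_all add: bij_letter bij_comp)

text \<open>The two products are conjugate: \<open>v\<close> maps the fixed points of
  \<open>u \<circ> v\<close> injectively to those of \<open>v \<circ> u\<close>.\<close>

lemma finite_fixpoints_conj:
  assumes "bij u" "bij v" and vu: "v \<circ> u = id \<or> finite {x. (v \<circ> u) x = x}"
  shows "u \<circ> v = id \<or> finite {x. (u \<circ> v) x = x}"
  using vu
proof
  assume "v \<circ> u = id"
  then show ?thesis
    using assms(1,2)
    by (metis bij_is_surj comp_assoc comp_id fun.map_id0 id_comp inv_unique_comp surj_iff)
next
  assume fin: "finite {x. (v \<circ> u) x = x}"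
  have "v ` {x. (u \<circ> v) x = x} \<subseteq> {x. (v \<circ> u) x = x}" by auto
  then have "finite {x. (u \<circ> v) x = x}"
    using fin assms(2) by (meson bij_is_inj finite_imageD finite_subset inj_on_subset subset_UNIV)
  then show ?thesis ..
qed

lemma word_absorb: "a \<circ> word g (l # w) = word g ((a \<circ> fst l, snd l) # w)"
  by (simp add: letter_def comp_assoc)

text \<open>A compactness argument: finitely many points and coefficients involve only finitely many
  pairs. A trail along the generic graph will therefore be found inside a single condition.\<close>

lemma trail_finite_subset:
  assumes "trail s b e q" "finite (range b)" "finite (range q)"
  obtains t where "t \<subseteq> s" "finite t" "trail t b e q"
proof
  let ?R = "range q \<union> (\<Union>f\<in>range b. f ` range q)"
  have "finite ?R" using assms(2,3) by blast
  then show "finite (s \<inter> ?R \<times> ?R)" by blast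
  have "b i (q (i + 1)) \<in> ?R" "q i \<in> ?R" for i by blast+
  then show "trail (s \<inter> ?R \<times> ?R) b e q"
    using assms(1) unfolding trail_def edge_def by (metis IntI SigmaI)
qed simp

text \<open>Unroll the cyclic word periodically and record the orbit of \<open>p\<close>; only
  finitely many positions occur, so the orbit has finite range. The last conclusion recovers
  \<open>p\<close> as an end point of the edge at index \<open>-1\<close>.\<close>

lemma fixpoint_trail:
  assumes g: "bij g" and w: "w \<noteq> []" "cyclically_reduced w" and p: "word g w p = p"
  obtains b e q where "range b \<subseteq> fst ` set w" "reduced_word b e" "trail {(x, g x) | x. True} b e q"
    "finite (range q)" "b (-1) (q 0) = p"
proof -
  define n where "n = length w"
  have n: "n > 0" using w(1) by (simp add: n_def)
  define j where "j i = nat (i mod int n)" for i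
  have j: "j i < n" for i using n by (simp add: j_def nat_less_iff)
  have jS: "j (i + 1) = Suc (j i) mod n" for i
  proof -
    have "int (Suc (j i) mod n) = (1 + i mod int n) mod int n"
      using n by (simp add: j_def zmod_int)
    also have "\<dots> = (i + 1) mod int n" by (simp add: mod_add_right_eq add.commute)
    finally show ?thesis by (simp add: j_def)
  qed
  define e where "e i = snd (w ! j i)" for i
  \<comment> \<open>The shift by one is needed because \<open>b i\<close> in a trail is the
    coefficient of the next letter. Below, \<open>F k\<close> is the point reached after the letters
    from position \<open>k\<close> on have acted, and \<open>q i\<close> the point where the power
    in letter \<open>j i\<close> has acted but its coefficient has not.\<close>
  define b where "b i = fst (w ! j (i + 1))" for i
  define F where "F k = word g (drop k w) p" for k
  define q where "q i = (if e i then g else inv_into UNIV g) (F (Suc (j i)))" for i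
  \<comment> \<open>The cycle closes because \<open>p\<close> is fixed.\<close>
  have "F n = F 0" using p by (simp add: F_def n_def)
  then have Fj: "F (j (i + 1)) = F (Suc (j i))" for i
    using j[of i] jS[of i] by (cases "Suc (j i) = n") auto
  have Fq: "fst (w ! j i) (q i) = F (j i)" for i
  proof -
    have "drop (j i) w = w ! j i # drop (Suc (j i)) w"
      using j[of i] by (simp add: Cons_nth_drop_Suc n_def)
    then show ?thesis by (simp add: F_def q_def e_def letter_def)
  qed
  have bq: "b i (q (i + 1)) = F (Suc (j i))" for i
    using Fq[of "i + 1"] Fj[of i] by (simp add: b_def)
  show ?thesis
  proof
    show "range b \<subseteq> fst ` set w" using j by (auto simp: b_def n_def)
    show "reduced_word b e"
      using w(2) j unfolding reduced_word_def cyclically_reduced_def b_def e_def jS n_def by blast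
    show "trail {(x, g x) | x. True} b e q"
      unfolding trail_def bq
      using g by (auto simp: edge_def q_def bij_is_surj surj_f_inv_f)
    have "range q \<subseteq> (\<lambda>k. (if snd (w ! k) then g else inv_into UNIV g) (F (Suc k))) ` {..<n}"
      using j by (auto simp: q_def e_def)
    then show "finite (range q)" using finite_surj by blast
    show "b (-1) (q 0) = p" using bq[of "-1"] Fj[of "-1"] p by (simp add: j_def F_def)
  qed
qed

section \<open>The forcing poset\<close>

lemma Bij_UNIV: "Bij UNIV = {f. bij f}"
  by (auto simp: Bij_def)

lemma BijGroup_UNIV_simps [simp]:
  "carrier (BijGroup UNIV) = {f. bij f}"
  "\<one>\<^bsub>BijGroup UNIV\<^esub> = id"
  "bij f \<Longrightarrow> bij h \<Longrightarrow> f \<otimes>\<^bsub>BijGroup UNIV\<^esub> h = f \<circ> h"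
  by (simp_all add: BijGroup_def Bij_UNIV compose_def restrict_UNIV comp_def id_def)

lemma BijGroup_UNIV_inv [simp]:
  assumes "bij f"
  shows "inv\<^bsub>BijGroup UNIV\<^esub> f = inv_into UNIV f"
proof (rule group.inv_equality[OF group_BijGroup])
  show "inv_into UNIV f \<otimes>\<^bsub>BijGroup UNIV\<^esub> f = \<one>\<^bsub>BijGroup UNIV\<^esub>"
    using assms by (simp add: bij_imp_bij_inv bij_is_inj)
qed (use assms in \<open>simp_all add: bij_imp_bij_inv\<close>)

lemma subgroup_BijGroup_iff:
  "subgroup G (BijGroup UNIV) \<longleftrightarrow> (\<forall>f\<in>G. bij f) \<and> id \<in> G \<and>
     (\<forall>f\<in>G. \<forall>h\<in>G. f \<circ> h \<in> G) \<and> (\<forall>f\<in>G. inv_into UNIV f \<in> G)" (is "?L \<longleftrightarrow> ?R")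
proof
  assume L: ?L
  have bij: "\<forall>f\<in>G. bij f" using subgroup.subset[OF L] by auto
  then show ?R
    using subgroup.one_closed[OF L] subgroup.m_closed[OF L] subgroup.m_inv_closed[OF L] by auto
next
  assume R: ?R
  then show ?L by unfold_locales auto
qed

section \<open>Conditions and their order\<close>

definition conditions :: "(nat \<Rightarrow> nat) set \<Rightarrow> ((nat \<times> nat) set \<times> (nat \<Rightarrow> nat) set) set" where
  "conditions G = {(s, A). finite s \<and> single_valued s \<and> single_valued (s\<inverse>) \<and> finite A \<and> A \<subseteq> G}"

lemma conditions_iff:
  "(s, A) \<in> conditions G \<longleftrightarrow>
     finite s \<and> single_valued s \<and> single_valued (s\<inverse>) \<and> finite A \<and> A \<subseteq> G"
  by (simp add: conditions_def)

definition stronger ::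
  "(nat \<Rightarrow> nat) set \<Rightarrow> ((nat \<times> nat) set \<times> (nat \<Rightarrow> nat) set) rel" where
  "stronger G = {((t, B), (s, A)). (t, B) \<in> conditions G \<and> (s, A) \<in> conditions G \<and>
     s \<subseteq> t \<and> A \<subseteq> B \<and> no_new_trails A s t}"

lemma stronger_iff:
  "((t, B), (s, A)) \<in> stronger G \<longleftrightarrow> (t, B) \<in> conditions G \<and> (s, A) \<in> conditions G \<and>
     s \<subseteq> t \<and> A \<subseteq> B \<and> no_new_trails A s t"
  by (simp add: stronger_def)

lemma preorder_stronger: "preorder_on (conditions G) (stronger G)"
proof -
  have "trans (stronger G)"
  proof (rule transI)
    fix x y z assume "(x, y) \<in> stronger G" "(y, z) \<in> stronger G"
    then show "(x, z) \<in> stronger G"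
      by (cases x, cases y, cases z) (auto simp: stronger_iff intro: no_new_trails_trans)
  qed
  moreover have "refl_on (conditions G) (stronger G)" "stronger G \<subseteq> conditions G \<times> conditions G"
    by (auto simp: refl_on_def stronger_iff no_new_trails_refl stronger_def)
  ultimately show ?thesis by (simp add: preorder_on_def)
qed

text \<open>Conditions with the same finite part are compatible by uniting their side sets, and
  finite parts are countably many, being coded by lists.\<close>

lemma sigma_centered_stronger: "sigma_centered (conditions G) (stronger G)"
  unfolding sigma_centered_def
proof (intro exI conjI allI impI)
  define C where "C k = {p \<in> conditions G. fst p = set (from_nat k)}" for k
  show "conditions G = (\<Union>k. C k)"
  proof -
    have "\<exists>k. s = set (from_nat k)" if "finite s" for s :: "(nat \<times> nat) set"
      using that by (metis finite_list from_nat_to_nat)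
    then show ?thesis unfolding C_def conditions_def by fastforce
  qed
  fix k F assume F: "F \<subseteq> C k \<and> finite F \<and> F \<noteq> {}"
  let ?q = "(set (from_nat k) :: (nat \<times> nat) set, \<Union> (snd ` F))"
  have q: "?q \<in> conditions G" using F unfolding C_def conditions_def by fastforce
  have "(?q, p) \<in> stronger G" if "p \<in> F" for p
    using that F q by (cases p) (auto simp: stronger_iff C_def no_new_trails_refl)
  then show "\<exists>q\<in>conditions G. \<forall>p\<in>F. (q, p) \<in> stronger G" using q by blast
qed

section \<open>One-point extensions of conditions\<close>

lemma conditions_insert:
  assumes G: "cofinitary_group G" and p: "(s, A) \<in> conditions G"
  obtains V where "finite V" "\<And>n m. n \<notin> Domain s \<Longrightarrow> m \<notin> V \<Longrightarrow>
    (\<And>a. a \<in> A \<union> inv_into UNIV ` A \<Longrightarrow> m \<noteq> a n) \<Longrightarrow> ((insert (n, m) s, A), (s, A)) \<in> stronger G"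
proof -
  have A: "finite A" "A \<subseteq> G" "finite s" using p by (auto simp: conditions_def)
  have "bij a" "a \<noteq> id \<Longrightarrow> finite {x. a x = x}" if "a \<in> A" for a
    using that A(2) G by (auto simp: cofinitary_group_def subgroup_BijGroup_iff)
  then obtain V where V: "finite V" "\<forall>n m. m \<notin> V \<and> (\<forall>a\<in>A \<union> inv_into UNIV ` A. m \<noteq> a n) \<longrightarrow>
     m \<notin> Domain s \<union> Range s \<and> no_new_trails A s (insert (n, m) s)"
    using finite_not_fresh[OF A(1) _ _ A(3)] by blast
  show thesis
  proof
    fix n m
    assume n: "n \<notin> Domain s" and m: "m \<notin> V" "\<And>a. a \<in> A \<union> inv_into UNIV ` A \<Longrightarrow> m \<noteq> a n"
    then have "m \<notin> Range s" "no_new_trails A s (insert (n, m) s)" using V(2) by blast+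
    moreover have "single_valued (insert (n, m) s)" "single_valued ((insert (n, m) s)\<inverse>)"
      using n p \<open>m \<notin> Range s\<close> unfolding conditions_iff single_valued_def by blast+
    ultimately show "((insert (n, m) s, A), (s, A)) \<in> stronger G"
      using p unfolding stronger_iff conditions_iff by blast
  qed (rule V(1))
qed

lemma conditions_converse: "(s\<inverse>, A) \<in> conditions G \<longleftrightarrow> (s, A) \<in> conditions G"
  unfolding conditions_iff converse_converse finite_converse by metis

lemma stronger_converse:
  assumes "((t\<inverse>, B), (s\<inverse>, A)) \<in> stronger G"
  shows "((t, B), (s, A)) \<in> stronger G"
proof -
  have "no_new_trails A s t"
    by (rule no_new_trails_converse) (use assms in \<open>simp only: stronger_iff\<close>)
  then show ?thesis using assms by (simp only: stronger_iff conditions_converse converse_mono)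
qed

lemma conditions_extend_Domain:
  assumes G: "cofinitary_group G" and p: "(s, A) \<in> conditions G"
  shows "\<exists>t. ((t, A), (s, A)) \<in> stronger G \<and> n \<in> Domain t"
proof (cases "n \<in> Domain s")
  case True
  then show ?thesis using p by (auto simp: stronger_iff no_new_trails_refl)
next
  case False
  obtain V where V: "finite V" "\<And>n m. n \<notin> Domain s \<Longrightarrow> m \<notin> V \<Longrightarrow>
    (\<And>a. a \<in> A \<union> inv_into UNIV ` A \<Longrightarrow> m \<noteq> a n) \<Longrightarrow> ((insert (n, m) s, A), (s, A)) \<in> stronger G"
    using conditions_insert[OF G p] by blast
  have "finite (V \<union> (\<lambda>a. a n) ` (A \<union> inv_into UNIV ` A))"
    using V(1) p by (auto simp: conditions_def)
  then obtain m where "m \<notin> V \<union> (\<lambda>a. a n) ` (A \<union> inv_into UNIV ` A)"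
    using ex_new_if_finite infinite_UNIV_nat by blast
  then have "((insert (n, m) s, A), (s, A)) \<in> stronger G" using V(2) False by blast
  then show ?thesis by blast
qed

lemma conditions_extend_Range:
  assumes "cofinitary_group G" "(s, A) \<in> conditions G"
  shows "\<exists>t. ((t, A), (s, A)) \<in> stronger G \<and> n \<in> Range t"
proof -
  have "(s\<inverse>, A) \<in> conditions G" using assms(2) by (simp only: conditions_converse)
  then obtain t where t: "((t, A), (s\<inverse>, A)) \<in> stronger G" "n \<in> Domain t"
    using conditions_extend_Domain[OF assms(1)] by blast
  have "((t\<inverse>, A), (s, A)) \<in> stronger G"
    by (rule stronger_converse) (simp only: converse_converse t(1))
  then show ?thesis using t(2) by blast
qed

section \<open>Pairs provided by positive trees\<close>

text \<open>Otherwise \<open>u\<close> and \<open>P\<close> would witness that \<open>T\<close> lies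
  in the ideal.\<close>

lemma positive_tree_extend:
  assumes T: "T \<in> tree_ideal_positive G" "u \<in> T" and P: "finite P" "P \<subseteq> G"
  obtains t k where "t \<in> T" "prefix u t" "k \<in> {..<length t} - {..<length u}" "\<And>f. f \<in> P \<Longrightarrow> t ! k \<noteq> f k"
proof (rule ccontr)
  assume "\<not> thesis"
  then have "\<forall>t\<in>T. prefix u t \<longrightarrow> (\<forall>k\<in>{..<length t} - {..<length u}. \<exists>f\<in>P. t ! k = f k)"
    using that by metis
  then have "T \<in> tree_ideal G" if "injective_tree T"
    unfolding tree_ideal_def using that T(2) P by blast
  then show False using T(1) unfolding tree_ideal_positive_def by blast
qed

lemma positive_tree_long:
  assumes T: "T \<in> tree_ideal_positive G" "u \<in> T"
  shows "\<exists>t\<in>T. prefix u t \<and> length t \<ge> N"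
proof (induction N)
  case 0
  then show ?case using T(2) by auto
next
  case (Suc N)
  then obtain t where t: "t \<in> T" "prefix u t" "length t \<ge> N" by blast
  \<comment> \<open>With no function to avoid, positivity still gives a proper extension.\<close>
  obtain t' k where "t' \<in> T" "prefix t t'" "k \<in> {..<length t'} - {..<length t}"
    using positive_tree_extend[OF T(1) t(1), of "{}"] by blast
  then show ?case using t by (intro bexI[of _ t']) auto
qed

text \<open>Along an injective branch each value from the finite set \<open>V\<close> occurs at most
  once. Beyond a node of length at least \<open>N\<close> that uses as many of these values as
  possible no further one occurs, and positivity avoids \<open>P\<close>.\<close>

lemma positive_tree_avoid:
  assumes T: "T \<in> tree_ideal_positive G" "u \<in> T" and P: "finite P" "P \<subseteq> G" and V: "finite V"
  obtains t k where "t \<in> T" "prefix u t" "k \<in> {..<length t} - {..<length u}" "k \<ge> N"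
    "t ! k \<notin> V" "\<And>f. f \<in> P \<Longrightarrow> t ! k \<noteq> f k"
proof -
  let ?Q = "\<lambda>v. v \<in> T \<and> prefix u v \<and> length v \<ge> N"
  have "\<exists>v. ?Q v" using positive_tree_long[OF T] by blast
  moreover have "\<forall>v. ?Q v \<longrightarrow> card (V \<inter> set v) < Suc (card V)"
    using V by (simp add: card_mono less_Suc_eq_le)
  ultimately obtain v where v: "?Q v" and max: "\<And>t. ?Q t \<Longrightarrow> card (V \<inter> set t) \<le> card (V \<inter> set v)"
    using ex_has_greatest_nat[of ?Q _ "\<lambda>v. card (V \<inter> set v)" "Suc (card V)"] by blast
  obtain t k where t: "t \<in> T" "prefix v t" "k \<in> {..<length t} - {..<length v}"
    "\<And>f. f \<in> P \<Longrightarrow> t ! k \<noteq> f k"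
    using positive_tree_extend[OF T(1) _ P] v by blast
  have Qt: "?Q t" using v t by (meson le_trans prefix_length_le prefix_order.trans)
  have "t ! k \<notin> V"
  proof
    assume kV: "t ! k \<in> V"
    obtain z where z: "t = v @ z" using t(2) by (auto simp: prefix_def)
    have "distinct t" using T(1) t(1) by (auto simp: tree_ideal_positive_def injective_tree_def)
    moreover have "t ! k \<in> set z" using t(3) z by (auto simp: nth_append)
    ultimately have "t ! k \<notin> set v" "t ! k \<in> set t" using z by auto
    then have "V \<inter> set v \<subset> V \<inter> set t" using kV z by auto
    then have "card (V \<inter> set v) < card (V \<inter> set t)" using V by (simp add: psubset_card_mono)
    then show False using max[OF Qt] by simp
  qed
  moreover have "length u \<le> length v" "N \<le> length v" using v by (auto dest: prefix_length_le)
  ultimately show thesis using that[of t k] t Qt by auto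
qed

text \<open>The inverses of the coefficients belong to the group \<open>G\<close> as well, so
  positivity avoids them too. Going beyond \<open>N\<close> keeps the new argument outside the
  domain of \<open>s\<close>.\<close>

lemma conditions_extend_tree:
  assumes G: "cofinitary_group G" and p: "(s, A) \<in> conditions G"
    and T: "T \<in> tree_ideal_positive G" "u \<in> T"
  shows "\<exists>t s' k. ((s', A), (s, A)) \<in> stronger G \<and> t \<in> T \<and> prefix u t \<and>
    k \<in> {..<length t} - {..<length u} \<and> (k, t ! k) \<in> s'"
proof -
  obtain V where V: "finite V" "\<And>n m. n \<notin> Domain s \<Longrightarrow> m \<notin> V \<Longrightarrow>
    (\<And>a. a \<in> A \<union> inv_into UNIV ` A \<Longrightarrow> m \<noteq> a n) \<Longrightarrow> ((insert (n, m) s, A), (s, A)) \<in> stronger G"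
    using conditions_insert[OF G p] by blast
  have A: "finite A" "A \<subseteq> G" "finite s" using p by (auto simp: conditions_def)
  have "A \<union> inv_into UNIV ` A \<subseteq> G"
    using A(2) G by (auto simp: cofinitary_group_def subgroup_BijGroup_iff)
  moreover have "finite (A \<union> inv_into UNIV ` A)" using A(1) by blast
  moreover obtain N where N: "\<And>n. n \<in> Domain s \<Longrightarrow> n < N"
    using A(3) finite_Domain finite_nat_set_iff_bounded by metis
  ultimately obtain t k where "t \<in> T" "prefix u t" "k \<in> {..<length t} - {..<length u}" "k \<ge> N"
    "t ! k \<notin> V" "\<And>f. f \<in> A \<union> inv_into UNIV ` A \<Longrightarrow> t ! k \<noteq> f k"
    using positive_tree_avoid[OF T, where P="A \<union> inv_into UNIV ` A" and N=N] V(1) by metis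
  moreover from this have "((insert (k, t ! k) s, A), (s, A)) \<in> stronger G"
    using V(2) N by (meson leD)
  ultimately show ?thesis by blast
qed

section \<open>The generic permutation\<close>

lemma trail_mono: "trail s b e q \<Longrightarrow> s \<subseteq> t \<Longrightarrow> trail t b e q"
  unfolding trail_def edge_def by (meson subsetD)

section \<open>Cardinalities below the continuum\<close>

lemma lesspoll_iff_ordLess: "A \<prec> B \<longleftrightarrow> ordLess2 (card_of A) (card_of B)"
proof -
  have "A \<prec> B \<longleftrightarrow> \<not> B \<lesssim> A"
    using lepoll_antisym lesspoll_def eqpoll_imp_lepoll eqpoll_sym lepoll_iff_ordLeq
    by (metis card_of_Well_order ordLeq_total)
  then show ?thesis
    unfolding lepoll_iff_ordLeq by (metis card_of_Well_order not_ordLeq_iff_ordLess)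
qed

lemma Un_lesspoll_real:
  "A \<prec> (UNIV :: real set) \<Longrightarrow> B \<prec> (UNIV :: real set) \<Longrightarrow> A \<union> B \<prec> (UNIV :: real set)"
  unfolding lesspoll_iff_ordLess
  by (rule card_of_Un_ordLess_infinite) (simp_all add: infinite_UNIV_char_0)

lemma countable_lesspoll_real:
  assumes "countable A"
  shows "A \<prec> (UNIV :: real set)"
proof -
  have "A \<lesssim> (UNIV :: nat set)" using assms by (metis countable_def lepoll_def subset_UNIV)
  also have "(UNIV :: nat set) \<prec> (UNIV :: nat set set)" using lesspoll_Pow_self[of "UNIV :: nat set"] by simp
  also have "\<dots> \<approx> (UNIV :: real set)" by (rule nat_sets_eqpoll_reals)
  finally show ?thesis .
qed

section \<open>The filter and its permutation\<close>

text \<open>For the last conclusion, take a condition \<open>(s, B)\<close> of the filter with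
  \<open>A \<subseteq> B\<close>. A trail of finite range uses a finite part of the graph, hence
  occurs in some condition below \<open>(s, B)\<close>, and the promise pulls it back to
  \<open>s\<close>. So \<open>s\<close> serves words of every length.\<close>

lemma generic_permutation:
  assumes MA: MA_sigma_centered and G: "cofinitary_group G" "G \<prec> (UNIV :: real set)"
    and T: "range (T :: nat \<Rightarrow> _) \<subseteq> tree_ideal_positive G"
  obtains g where "bij g" "\<And>n. densely_diagonalizes g (T n)"
    "\<And>A. finite A \<Longrightarrow> A \<subseteq> G \<Longrightarrow> \<exists>s. finite s \<and> (\<forall>b e q. range b \<subseteq> A \<and> reduced_word b e \<and>
       finite (range q) \<and> trail {(x, g x) | x. True} b e q \<longrightarrow> trail s b e q)"
proof -
  let ?C = "conditions G"
  \<comment> \<open>\<open>D1\<close> puts an element of \<open>G\<close> into a side set,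
    \<open>D2\<close> and \<open>D3\<close> make the generic function total and surjective, and
    \<open>D4\<close> treats one node of one tree. Only the first family can be uncountable.\<close>
  define D1 where "D1 a = {p \<in> ?C. a \<in> snd p}" for a
  define D2 where "D2 n = {p \<in> ?C. n \<in> Domain (fst p)}" for n
  define D3 where "D3 n = {p \<in> ?C. n \<in> Range (fst p)}" for n
  define D4 where "D4 = (\<lambda>(n, u). {p \<in> ?C. \<exists>t\<in>T n. prefix u t \<and>
    (\<exists>k\<in>{..<length t} - {..<length u}. (k, t ! k) \<in> fst p)})"
  define \<D> where "\<D> = D1 ` G \<union> (range D2 \<union> range D3 \<union> D4 ` (SIGMA n:UNIV. T n))"
  have "D1 ` G \<prec> (UNIV :: real set)" using image_lepoll G(2) by (rule lesspoll_trans1)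
  then have "\<D> \<prec> (UNIV :: real set)"
    unfolding \<D>_def by (rule Un_lesspoll_real) (intro countable_lesspoll_real, auto)
  moreover have "dense_in_poset ?C (stronger G) D" if D: "D \<in> \<D>" for D
  proof -
    have "D \<subseteq> ?C" using D unfolding \<D>_def D1_def D2_def D3_def D4_def by auto
    moreover have "\<exists>d\<in>D. (d, (s, A)) \<in> stronger G" if p: "(s, A) \<in> ?C" for s A
    proof -
      consider a where "a \<in> G" "D = D1 a" | n where "D = D2 n" | n where "D = D3 n"
        | n u where "u \<in> T n" "D = D4 (n, u)"
        using D unfolding \<D>_def by blast
      then show ?thesis
      proof cases
        case 1
        have "(s, insert a A) \<in> ?C" using p 1(1) by (simp add: conditions_iff)
        then show ?thesis using p 1(2)
          by (intro bexI[of _ "(s, insert a A)"]) (auto simp: stronger_iff D1_def no_new_trails_refl)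
      next
        case 2
        obtain t where t: "((t, A), (s, A)) \<in> stronger G" "n \<in> Domain t"
          using conditions_extend_Domain[OF G(1) p] by blast
        then have "(t, A) \<in> D" by (simp add: 2 D2_def stronger_iff)
        then show ?thesis using t by blast
      next
        case 3
        obtain t where t: "((t, A), (s, A)) \<in> stronger G" "n \<in> Range t"
          using conditions_extend_Range[OF G(1) p] by blast
        then have "(t, A) \<in> D" by (simp add: 3 D3_def stronger_iff)
        then show ?thesis using t by blast
      next
        case 4
        have "T n \<in> tree_ideal_positive G" using T by blast
        then obtain t s' k where t: "((s', A), (s, A)) \<in> stronger G" "t \<in> T n" "prefix u t"
          "k \<in> {..<length t} - {..<length u}" "(k, t ! k) \<in> s'"
          using conditions_extend_tree[OF G(1) p _ 4(1)] by blast
        have "(s', A) \<in> ?C" using t(1) by (simp add: stronger_iff)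
        then have "(s', A) \<in> D" using t(2-5) unfolding 4(2) D4_def prod.case mem_Collect_eq fst_conv by blast
        then show ?thesis using t(1) by blast
      qed
    qed
    ultimately show ?thesis unfolding dense_in_poset_def by auto
  qed
  moreover have "({}, {}) \<in> ?C" by (simp add: conditions_iff)
  then have "meets_dense_families ?C (stronger G)"
    using MA_sigma_centeredD[OF MA preorder_stronger _ sigma_centered_stronger] by blast
  ultimately obtain F where F: "poset_filter ?C (stronger G) F" and FD: "\<And>D. D \<in> \<D> \<Longrightarrow> F \<inter> D \<noteq> {}"
    unfolding meets_dense_families_def by metis
  have FC: "F \<subseteq> ?C" "F \<noteq> {}" using F by (auto simp: poset_filter_def)
  have dir: "\<exists>r\<in>F. (r, p) \<in> stronger G \<and> (r, p') \<in> stronger G" if "p \<in> F" "p' \<in> F" for p p'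
    using F that unfolding poset_filter_def by blast
  have dir': "\<exists>r\<in>F. fst p \<union> fst p' \<subseteq> fst r \<and> snd p \<union> snd p' \<subseteq> snd r" if pp: "p \<in> F" "p' \<in> F" for p p'
  proof -
    obtain r where r: "r \<in> F" "(r, p) \<in> stronger G" "(r, p') \<in> stronger G" using dir[OF pp] by blast
    then show ?thesis
      by (intro bexI[of _ r]; cases r; cases p; cases p') (auto simp: stronger_iff)
  qed
  define gr where "gr = \<Union> (fst ` F)"
  \<comment> \<open>Directedness places any finite part of the graph inside one condition of the
    filter.\<close>
  have gr: "\<exists>p\<in>F. t \<subseteq> fst p" if "finite t" "t \<subseteq> gr" for t
    using that
  proof (induction t)
    case empty
    then show ?case using FC by blast
  next
    case (insert x t)
    then obtain p p' where "p \<in> F" "t \<subseteq> fst p" "p' \<in> F" "x \<in> fst p'" by (auto simp: gr_def)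
    then show ?case using dir'[of p p'] by blast
  qed
  have sv: "single_valued gr" "single_valued (gr\<inverse>)"
  proof -
    have "y = z" if "(x, y) \<in> gr" "(x, z) \<in> gr" for x y z
    proof -
      obtain p where p: "p \<in> F" "{(x, y), (x, z)} \<subseteq> fst p"
        using gr[of "{(x, y), (x, z)}"] \<open>(x, y) \<in> gr\<close> \<open>(x, z) \<in> gr\<close> by auto
      then have "single_valued (fst p)" using FC(1) by (cases p) (auto simp: conditions_iff)
      then show ?thesis using p(2) by (auto dest: single_valuedD)
    qed
    then show "single_valued gr" by (meson single_valuedI)
    have "y = z" if "(y, x) \<in> gr" "(z, x) \<in> gr" for x y z
    proof -
      obtain p where p: "p \<in> F" "{(y, x), (z, x)} \<subseteq> fst p"
        using gr[of "{(y, x), (z, x)}"] \<open>(y, x) \<in> gr\<close> \<open>(z, x) \<in> gr\<close> by auto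
      then have "single_valued ((fst p)\<inverse>)" using FC(1) by (cases p) (auto simp: conditions_iff)
      then show ?thesis using p(2) by (auto dest: single_valuedD)
    qed
    then show "single_valued (gr\<inverse>)" by (meson single_valuedI converseD)
  qed
  have "n \<in> Domain gr" for n
  proof -
    have "D2 n \<in> \<D>" unfolding \<D>_def by blast
    then obtain p where "p \<in> F" "p \<in> D2 n" using FD by blast
    then show ?thesis unfolding gr_def D2_def by blast
  qed
  then obtain g where g: "\<And>x. (x, g x) \<in> gr" by (meson DomainE)
  have gr_eq: "(x, y) \<in> gr \<longleftrightarrow> y = g x" for x y using g sv(1) by (metis single_valuedD)
  then have gr_eq': "gr = {(x, g x) | x. True}" by auto
  have "surj g"
  proof -
    have "\<exists>x. n = g x" for n
    proof -
      have "D3 n \<in> \<D>" unfolding \<D>_def by blast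
      then obtain p where "p \<in> F" "p \<in> D3 n" using FD by blast
      then have "n \<in> Range gr" unfolding gr_def D3_def by blast
      then show ?thesis using gr_eq by blast
    qed
    then show ?thesis by (simp add: surj_def)
  qed
  moreover have "inj g"
    using g sv(2) by (intro injI) (metis converse.intros single_valuedD)
  ultimately have "bij g" by (simp add: bij_def)
  moreover have "densely_diagonalizes g (T n)" for n
    unfolding densely_diagonalizes_def
  proof
    fix u assume "u \<in> T n"
    then have "D4 (n, u) \<in> \<D>" unfolding \<D>_def by blast
    then obtain p where p: "p \<in> F" "p \<in> D4 (n, u)" using FD by blast
    then obtain t k where t: "t \<in> T n" "prefix u t" "k \<in> {..<length t} - {..<length u}" "(k, t ! k) \<in> fst p"
      unfolding D4_def by auto
    then have "t ! k = g k" using p(1) gr_eq unfolding gr_def by blast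
    then show "\<exists>t\<in>T n. prefix u t \<and> (\<exists>k\<in>{..<length t} - {..<length u}. t ! k = g k)"
      using t by blast
  qed
  moreover have "\<exists>s. finite s \<and> (\<forall>b e q. range b \<subseteq> A \<and> reduced_word b e \<and>
       finite (range q) \<and> trail {(x, g x) | x. True} b e q \<longrightarrow> trail s b e q)"
    if A: "finite A" "A \<subseteq> G" for A
  proof -
    have "\<exists>p\<in>F. A \<subseteq> snd p"
      using A
    proof (induction A)
      case empty
      then show ?case using FC by blast
    next
      case (insert a A)
      then have "D1 a \<in> \<D>" unfolding \<D>_def by blast
      then obtain p where "p \<in> F" "a \<in> snd p" using FD unfolding D1_def by blast
      moreover obtain p' where "p' \<in> F" "A \<subseteq> snd p'" using insert by blast
      ultimately show ?case using dir'[of p p'] by blast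
    qed
    then obtain s B where sB: "(s, B) \<in> F" "A \<subseteq> B" by auto
    have "trail s b e q" if t: "range b \<subseteq> A" "reduced_word b e" "finite (range q)" "trail gr b e q" for b e q
    proof -
      have "finite (range b)" using t(1) A(1) by (rule finite_subset)
      then obtain t where t': "t \<subseteq> gr" "finite t" "trail t b e q"
        using trail_finite_subset[OF t(4)] t(3) by blast
      then obtain p where p: "p \<in> F" "t \<subseteq> fst p" using gr by blast
      \<comment> \<open>The condition containing the trail need not lie below \<open>(s, B)\<close>
        itself, hence the common strengthening.\<close>
      then obtain r where r: "r \<in> F" "(r, p) \<in> stronger G" "(r, (s, B)) \<in> stronger G"
        using dir sB(1) by blast
      obtain u U where u: "r = (u, U)" by (cases r)
      have "t \<subseteq> u" using r(2) p(2) unfolding u by (cases p) (auto simp: stronger_iff)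
      then have "trail u b e q" using t'(3) trail_mono by blast
      moreover have "no_new_trails B s u" using r(3) by (simp add: u stronger_iff)
      moreover have "range b \<subseteq> B" using t(1) sB(2) by (rule subset_trans)
      ultimately show ?thesis using t(2) unfolding no_new_trails_def by blast
    qed
    moreover have "finite s" using sB(1) FC(1) by (auto simp: conditions_iff)
    ultimately show ?thesis unfolding gr_eq' by blast
  qed
  ultimately show thesis by (rule that)
qed

section \<open>Fixed points in the extended group\<close>

text \<open>One finite \<open>s\<close> serves all fixed points: each is an end point of a pair in
  \<open>s\<close>.\<close>

lemma finite_fixpoints_cyclically_reduced:
  assumes g: "bij g"
    and gen: "\<exists>s. finite s \<and> (\<forall>b e q. range b \<subseteq> fst ` set w \<and> reduced_word b e \<and>
       finite (range q) \<and> trail {(x, g x) | x. True} b e q \<longrightarrow> trail s b e q)"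
    and w: "w \<noteq> []" "cyclically_reduced w"
  shows "finite {x. word g w x = x}"
proof -
  obtain s where s: "finite s" "\<forall>b e q. range b \<subseteq> fst ` set w \<and> reduced_word b e \<and>
       finite (range q) \<and> trail {(x, g x) | x. True} b e q \<longrightarrow> trail s b e q"
    using gen by (elim exE conjE)
  have "p \<in> Domain s \<union> Range s" if p: "word g w p = p" for p
  proof -
    obtain b e q where "range b \<subseteq> fst ` set w" "reduced_word b e" "trail {(x, g x) | x. True} b e q"
      "finite (range q)" and q: "b (-1) (q 0) = p"
      using fixpoint_trail[OF g w p] by blast
    then have "trail s b e q" using s(2) by blast
    then have "edge s (e (-1)) (b (-1) (q (-1 + 1))) (q (-1))" unfolding trail_def by blast
    then show ?thesis using q by (auto simp: edge_def split: if_splits)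
  qed
  then have "{x. word g w x = x} \<subseteq> Domain s \<union> Range s" by blast
  then show ?thesis using s(1) by (meson finite_Domain finite_Range finite_UnI finite_subset)
qed

text \<open>Every word is conjugate to a cyclically reduced one or to an element of the group.\<close>

lemma word_fixpoints:
  assumes G: "cofinitary_group G" and g: "bij g"
    and red: "\<And>w. w \<noteq> [] \<Longrightarrow> fst ` set w \<subseteq> G \<Longrightarrow> cyclically_reduced w \<Longrightarrow> finite {x. word g w x = x}"
    and w: "fst ` set w \<subseteq> G"
  shows "word g w = id \<or> finite {x. word g w x = x}"
  using w
proof (induction w rule: length_induct)
  case (1 w)
  have bijG: "bij a" if "a \<in> G" for a using G that by (simp add: cofinitary_group_def subgroup_BijGroup_iff)
  have mult: "a \<circ> b \<in> G" if "a \<in> G" "b \<in> G" for a b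
    using G that by (simp add: cofinitary_group_def subgroup_BijGroup_iff)
  have fixG: "a = id \<or> finite {x. a x = x}" if "a \<in> G" for a
    using G that by (auto simp: cofinitary_group_def)
  have bijw: "bij (word g v)" if "fst ` set v \<subseteq> G" for v
    using that bijG by (intro bij_word[OF g]) auto
  show ?case
  proof (cases "w = [] \<or> cyclically_reduced w")
    case True
    then show ?thesis using red[OF _ 1(2)] by (cases "w = []") simp_all
  next
    case False
    then obtain i where i: "i < length w" "snd (w ! i) \<noteq> snd (w ! (Suc i mod length w))"
      "fst (w ! (Suc i mod length w)) = id"
      unfolding cyclically_reduced_def by blast
    have len: "length w \<ge> 2"
    proof (rule ccontr)
      assume "\<not> length w \<ge> 2"
      then have "length w = 1" using i(1) by linarith
      then show False using i(1,2) by simp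
    qed
    \<comment> \<open>Rotation brings the cancelling letters to the front, also when they are the
      last and the first one.\<close>
    define v where "v = rotate i w"
    have "w \<noteq> []" using len by auto
    then have v0: "v ! 0 = w ! i" "v ! 1 = w ! (Suc i mod length w)"
      using nth_rotate[of 0 w i] nth_rotate[of 1 w i] len i(1) by (auto simp: v_def)
    obtain l l' r where v: "v = l # l' # r"
      using len unfolding v_def by (metis One_nat_def Suc_1 Suc_le_length_iff length_rotate)
    have ll: "snd l \<noteq> snd l'" "fst l' = id" using v0 i by (simp_all add: v)
    have setv: "set v = set w" by (simp add: v_def)
    have lr: "fst l \<in> G" "fst ` set r \<subseteq> G" using 1(2) unfolding setv[symmetric] v by auto
    have "letter g l \<circ> letter g l' = fst l"
      using ll g by (cases "snd l") (auto simp: letter_def fun_eq_iff bij_is_surj surj_f_inv_f bij_is_inj)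
    then have wv: "word g v = fst l \<circ> word g r" by (simp add: v comp_assoc[symmetric])
    \<comment> \<open>If no letter is left, the surviving coefficient is an element of
      \<open>G\<close>; otherwise it merges into the next letter and the word has become shorter by
      two.\<close>
    have Pv: "word g v = id \<or> finite {x. word g v x = x}"
    proof (cases r)
      case Nil
      then show ?thesis using fixG[OF lr(1)] by (simp add: wv)
    next
      case (Cons l'' r')
      have "length w = length v" by (simp add: v_def)
      then have "length ((fst l \<circ> fst l'', snd l'') # r') < length w" using Cons v by simp
      moreover have "fst ` set ((fst l \<circ> fst l'', snd l'') # r') \<subseteq> G" using lr mult Cons by auto
      ultimately show ?thesis unfolding wv Cons word_absorb using 1(1) by blast
    qed
    \<comment> \<open>Rotation exchanges two factors of the word, so it amounts to a
      conjugation.\<close>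
    have "v = drop i w @ take i w" using i(1) by (simp add: v_def rotate_drop_take)
    then have v': "word g v = word g (drop i w) \<circ> word g (take i w)" by (simp add: word_append)
    have w': "word g w = word g (take i w) \<circ> word g (drop i w)"
      by (metis append_take_drop_id word_append)
    have "fst ` set (take i w) \<subseteq> G" "fst ` set (drop i w) \<subseteq> G"
      using 1(2) set_take_subset[of i w] set_drop_subset[of i w] by blast+
    then show ?thesis
      unfolding w' using Pv[unfolded v'] bijw by (rule_tac finite_fixpoints_conj)
  qed
qed

text \<open>A nonempty word has a power of \<open>g\<close> as its rightmost factor, hence the
  trailing coefficient \<open>b\<close>. In a product it is absorbed by the first letter of the
  second word.\<close>

lemma generate_insert_word:
  assumes G: "subgroup G (BijGroup UNIV)" and g: "bij g"
    and h: "h \<in> generate (BijGroup UNIV) (insert g G)"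
  shows "\<exists>w b. fst ` set w \<subseteq> G \<and> b \<in> G \<and> h = word g w \<circ> b"
proof -
  have G': "\<And>a. a \<in> G \<Longrightarrow> bij a" "id \<in> G" "\<And>a b. a \<in> G \<Longrightarrow> b \<in> G \<Longrightarrow> a \<circ> b \<in> G"
    "\<And>a. a \<in> G \<Longrightarrow> inv_into UNIV a \<in> G"
    using G by (simp_all add: subgroup_BijGroup_iff)
  have inG: "\<exists>w b. fst ` set w \<subseteq> G \<and> b \<in> G \<and> a = word g w \<circ> b" if "a \<in> G" for a
    using that by (intro exI[of _ "[]"] exI[of _ a]) simp
  show ?thesis
    using h
  proof induction
    case one
    then show ?case using inG[OF G'(2)] by (simp only: BijGroup_UNIV_simps)
  next
    case (incl h)
    show ?case
    proof (cases "h \<in> G")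
      case False
      then have "h = word g [(id, True)] \<circ> id" using incl by (simp add: letter_def)
      then show ?thesis using G'(2) by (intro exI[of _ "[(id, True)]"] exI[of _ id]) (auto simp: id_def)
    qed (rule inG)
  next
    case (inv h)
    show ?case
    proof (cases "h \<in> G")
      case True
      then show ?thesis using inG[OF G'(4)[OF True]] by (simp only: BijGroup_UNIV_inv[OF G'(1)[OF True]])
    next
      case False
      then have "inv\<^bsub>BijGroup UNIV\<^esub> h = word g [(id, False)] \<circ> id" using inv g by (simp add: letter_def)
      then show ?thesis using G'(2) by (intro exI[of _ "[(id, False)]"] exI[of _ id]) (auto simp: id_def)
    qed
  next
    case (eng h1 h2)
    obtain w1 b1 where 1: "fst ` set w1 \<subseteq> G" "b1 \<in> G" "h1 = word g w1 \<circ> b1" using eng by blast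
    obtain w2 b2 where 2: "fst ` set w2 \<subseteq> G" "b2 \<in> G" "h2 = word g w2 \<circ> b2" using eng by blast
    have "bij h1" "bij h2" using 1 2 G'(1) g by (auto intro!: bij_comp bij_word)
    then have h: "h1 \<otimes>\<^bsub>BijGroup UNIV\<^esub> h2 = h1 \<circ> h2" by simp
    show ?case
    proof (cases w2)
      case Nil
      then show ?thesis unfolding h using 1 2 G'(3)[OF 1(2) 2(2)]
        by (intro exI[of _ w1] exI[of _ "b1 \<circ> b2"]) (simp add: comp_def)
    next
      case (Cons l w)
      have "h1 \<circ> h2 = word g w1 \<circ> (b1 \<circ> word g (l # w)) \<circ> b2"
        by (simp only: 1(3) 2(3) Cons comp_assoc)
      also have "\<dots> = word g (w1 @ (b1 \<circ> fst l, snd l) # w) \<circ> b2"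
        by (simp only: word_absorb word_append)
      finally show ?thesis unfolding h using 1 2 G'(3) Cons
        by (intro exI[of _ "w1 @ (b1 \<circ> fst l, snd l) # w"] exI[of _ b2]) auto
    qed
  qed
qed

lemma adjoin_diagonalizing_permutation:
  assumes MA: MA_sigma_centered and G: "cofinitary_group G" "G \<prec> (UNIV :: real set)"
  obtains g where "cofinitary_group (generate (BijGroup UNIV) (insert g G))" "g \<notin> G"
    "\<And>n :: nat. T n \<in> tree_ideal_positive G \<Longrightarrow> densely_diagonalizes g (T n)"
proof -
  \<comment> \<open>Trees that are not positive are replaced by the empty tree, which is positive
    because the ideal asks for a node \<open>s\<close>.\<close>
  define T' where "T' n = (if T n \<in> tree_ideal_positive G then T n else {})" for n
  have "{} \<in> tree_ideal_positive G"
    by (simp add: tree_ideal_positive_def tree_ideal_def injective_tree_def)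
  then have T': "range T' \<subseteq> tree_ideal_positive G" by (auto simp: T'_def)
  obtain g where g: "bij g" "\<And>n. densely_diagonalizes g (T' n)"
    and gen: "\<And>A. finite A \<Longrightarrow> A \<subseteq> G \<Longrightarrow> \<exists>s. finite s \<and> (\<forall>b e q. range b \<subseteq> A \<and> reduced_word b e \<and>
       finite (range q) \<and> trail {(x, g x) | x. True} b e q \<longrightarrow> trail s b e q)"
    using that by (rule generic_permutation[OF MA G T'])
  have sub: "subgroup G (BijGroup UNIV)" using G(1) by (simp add: cofinitary_group_def)
  then have G': "\<And>a. a \<in> G \<Longrightarrow> bij a" "\<And>a b. a \<in> G \<Longrightarrow> b \<in> G \<Longrightarrow> a \<circ> b \<in> G"
    "\<And>a. a \<in> G \<Longrightarrow> inv_into UNIV a \<in> G"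
    by (simp_all add: subgroup_BijGroup_iff)
  have red: "finite {x. word g w x = x}"
    if "w \<noteq> []" "fst ` set w \<subseteq> G" "cyclically_reduced w" for w
    by (rule finite_fixpoints_cyclically_reduced[OF g(1) gen]) (use that in auto)
  have "h = id \<or> finite {x. h x = x}" if h: "h \<in> generate (BijGroup UNIV) (insert g G)" for h
  proof -
    obtain w b where w: "fst ` set w \<subseteq> G" "b \<in> G" "h = word g w \<circ> b"
      using generate_insert_word[OF sub g(1) h] by blast
    \<comment> \<open>Conjugation moves \<open>b\<close> to the front, where the first letter
      absorbs it.\<close>
    have "b \<circ> word g w = id \<or> finite {x. (b \<circ> word g w) x = x}"
    proof (cases w)
      case Nil
      then show ?thesis using G(1) w(2) by (auto simp: cofinitary_group_def)
    next
      case (Cons l v)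
      show ?thesis unfolding Cons word_absorb
        by (rule word_fixpoints[OF G(1) g(1) red]) (use w G'(2) Cons in auto)
    qed
    moreover have "bij (word g w)" using w(1) G'(1) g(1) by (intro bij_word) auto
    ultimately show ?thesis unfolding w(3) using G'(1)[OF w(2)] by (rule_tac finite_fixpoints_conj)
  qed
  moreover have "subgroup (generate (BijGroup UNIV) (insert g G)) (BijGroup UNIV)"
    by (rule group.generate_is_subgroup[OF group_BijGroup]) (use g(1) G'(1) in auto)
  ultimately have "cofinitary_group (generate (BijGroup UNIV) (insert g G))"
    by (auto simp: cofinitary_group_def)
  moreover have "g \<notin> G"
  proof
    assume "g \<in> G"
    \<comment> \<open>This cyclically reduced word of one letter evaluates to the identity, which
      fixes every point.\<close>
    then have "finite {x. word g [(inv_into UNIV g, True)] x = x}"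
      using G'(3) by (intro red) (auto simp: cyclically_reduced_def)
    then show False using g(1) by (simp add: letter_def bij_is_inj)
  qed
  moreover have "densely_diagonalizes g (T n)" if "T n \<in> tree_ideal_positive G" for n
    using g(2)[of n] that by (simp add: T'_def)
  ultimately show thesis using that by blast
qed

section \<open>The transfinite construction\<close>

lemma lists_lepoll_infinite:
  assumes inf: "infinite Y"
  shows "lists Y \<lesssim> Y"
proof -
  have "{xs \<in> lists Y. length xs = m} \<lesssim> Y" for m
  proof (induction m)
    case 0
    have "{xs \<in> lists Y. length xs = 0} = {[]}" by auto
    then show ?case by (simp add: finite_lepoll_infinite inf)
  next
    case (Suc m)
    have "{xs \<in> lists Y. length xs = Suc m} \<subseteq>
        (\<lambda>(x, xs). x # xs) ` (Y \<times> {xs \<in> lists Y. length xs = m})"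
      by (auto simp: length_Suc_conv image_iff)
    then have "{xs \<in> lists Y. length xs = Suc m} \<lesssim> Y \<times> {xs \<in> lists Y. length xs = m}"
      by (rule subset_image_lepoll)
    also have "\<dots> \<lesssim> Y \<times> Y"
      using Suc.IH by (intro times_lepoll_mono) simp_all
    also have "\<dots> \<lesssim> Y"
      using card_of_Times_same_infinite[OF inf] eqpoll_iff_card_of_ordIso eqpoll_imp_lepoll by blast
    finally show ?case .
  qed
  moreover have "(UNIV :: nat set) \<lesssim> Y" using inf by (simp add: infinite_le_lepoll)
  ultimately have "(\<Union>m. {xs \<in> lists Y. length xs = m}) \<lesssim> Y"
    unfolding lepoll_iff_ordLeq by (intro card_of_UNION_ordLeq_infinite[OF inf]) simp_all
  moreover have "lists Y = (\<Union>m. {xs \<in> lists Y. length xs = m})" by auto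
  ultimately show ?thesis by simp
qed

lemma lists_lesspoll_real:
  assumes "Y \<prec> (UNIV :: real set)"
  shows "lists Y \<prec> (UNIV :: real set)"
proof (cases "finite Y")
  case True
  then show ?thesis by (intro countable_lesspoll_real countable_lists countable_finite)
next
  case False
  then show ?thesis using lists_lepoll_infinite assms lesspoll_trans1 by blast
qed

text \<open>Elements of the generated group are finite products of generators and their inverses,
  and there are fewer than continuum many lists of these.\<close>

lemma generate_lesspoll_real:
  assumes bij: "\<And>f. f \<in> X \<Longrightarrow> bij f" and X: "X \<prec> (UNIV :: real set)"
  shows "generate (BijGroup UNIV) X \<prec> (UNIV :: real set)"
proof -
  let ?Y = "X \<union> inv_into UNIV ` X"
  have gen: "\<exists>xs\<in>lists ?Y. h = foldr (\<circ>) xs id" if "h \<in> generate (BijGroup UNIV) X" for h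
    using that
  proof induction
    case one
    then show ?case by (intro bexI[of _ "[]"]) simp_all
  next
    case (incl h)
    then show ?case by (intro bexI[of _ "[h]"]) simp_all
  next
    case (inv h)
    then show ?case using bij by (intro bexI[of _ "[inv_into UNIV h]"]) simp_all
  next
    case (eng h1 h2)
    then obtain xs ys where xs: "xs \<in> lists ?Y" "h1 = foldr (\<circ>) xs id"
      and ys: "ys \<in> lists ?Y" "h2 = foldr (\<circ>) ys id" by blast
    have *: "foldr (\<circ>) us id \<circ> v = foldr (\<circ>) us v" for us :: "('a \<Rightarrow> 'a) list" and v
      by (induction us) (auto simp: fun_eq_iff)
    have "X \<subseteq> carrier (BijGroup UNIV)" using bij by auto
    then have "h1 \<in> carrier (BijGroup UNIV)" "h2 \<in> carrier (BijGroup UNIV)"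
      using eng(1,2) group.generate_in_carrier[OF group_BijGroup] by blast+
    then have "h1 \<otimes>\<^bsub>BijGroup UNIV\<^esub> h2 = foldr (\<circ>) (xs @ ys) id"
      unfolding xs ys by (simp add: *)
    then show ?case by (rule bexI) (use xs(1) ys(1) in simp)
  qed
  have "inv_into UNIV ` X \<prec> (UNIV :: real set)" using image_lepoll X by (rule lesspoll_trans1)
  then have "lists ?Y \<prec> (UNIV :: real set)" using X by (intro lists_lesspoll_real Un_lesspoll_real)
  moreover have "generate (BijGroup UNIV) X \<subseteq> (\<lambda>xs. foldr (\<circ>) xs id) ` lists ?Y"
    using gen by blast
  then have "generate (BijGroup UNIV) X \<lesssim> lists ?Y" by (rule subset_image_lepoll)
  ultimately show ?thesis using lesspoll_trans1 by blast
qed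

section \<open>Chains of cofinitary groups\<close>

text \<open>A product involves finitely many generators, and the largest of their indices bounds the
  others. The alternative \<open>h \<in> G\<close> covers elements that need no index, as when
  \<open>Y\<close> is empty.\<close>

lemma generate_linear_union:
  assumes G: "subgroup G K" and r: "linear_order r"
    and h: "h \<in> generate K (G \<union> f ` Y)"
  shows "h \<in> G \<or> (\<exists>y\<in>Y. h \<in> generate K (G \<union> f ` under r y))"
proof -
  have mono: "generate K (G \<union> f ` under r y) \<subseteq> generate K (G \<union> f ` under r z)" if "(y, z) \<in> r" for y z
  proof -
    have "G \<union> f ` under r y \<subseteq> G \<union> f ` under r z"
      using r that unfolding order_on_defs under_def by (blast dest: transD)
    moreover have "generate K A \<subseteq> generate K B" if "A \<subseteq> B" for A B
    proof
      show "x \<in> generate K B" if "x \<in> generate K A" for x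
        using that by induction (use \<open>A \<subseteq> B\<close> in \<open>auto intro: generate.intros\<close>)
    qed
    ultimately show ?thesis by blast
  qed
  have refl: "y \<in> under r y" for y
    using r unfolding order_on_defs refl_on_def under_def by blast
  show ?thesis
    using h
  proof induction
    case one
    then show ?case using subgroup.one_closed[OF G] by blast
  next
    case (incl h)
    then show ?case using refl generate.incl[of h "G \<union> f ` under r _" K] by blast
  next
    case (inv h)
    then show ?case
      using refl generate.inv[of h "G \<union> f ` under r _" K] subgroup.m_inv_closed[OF G] by blast
  next
    case (eng h1 h2)
    have up: "h \<in> generate K (G \<union> f ` under r z)"
      if "h \<in> G \<or> h \<in> generate K (G \<union> f ` under r y) \<and> (y, z) \<in> r" for h y z
      using that mono generate.incl[of h "G \<union> f ` under r z" K] by blast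
    show ?case
    proof (cases "h1 \<in> G \<and> h2 \<in> G")
      case True
      then show ?thesis using subgroup.m_closed[OF G] by blast
    next
      case False
      have total: "(y, z) \<in> r \<or> (z, y) \<in> r" for y z
        using r refl[of y] by (cases "y = z") (auto simp: linear_order_on_def total_on_def under_def)
      consider y where "h1 \<in> G" "y \<in> Y" "h2 \<in> generate K (G \<union> f ` under r y)"
        | y where "h2 \<in> G" "y \<in> Y" "h1 \<in> generate K (G \<union> f ` under r y)"
        | y z where "y \<in> Y" "h1 \<in> generate K (G \<union> f ` under r y)"
          "z \<in> Y" "h2 \<in> generate K (G \<union> f ` under r z)"
        using False eng(3,4) by blast
      then obtain z where "z \<in> Y"
        "h1 \<in> generate K (G \<union> f ` under r z)" "h2 \<in> generate K (G \<union> f ` under r z)"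
      proof cases
        case (3 y z)
        then show ?thesis using total[of y z] up that by blast
      qed (use up that in blast)+
      then show ?thesis using generate.eng[of h1 K "G \<union> f ` under r z" h2] by blast
    qed
  qed
qed

text \<open>Cofinitariness concerns one element at a time, and each element appears by some stage
  \<open>y\<close>. Initial segments as \<open>Y\<close> serve the stages of the recursion, the
  whole type its final group.\<close>

lemma cofinitary_group_linear_union:
  assumes G: "cofinitary_group G" and r: "linear_order r"
    and step: "\<And>y. y \<in> Y \<Longrightarrow> cofinitary_group (generate (BijGroup UNIV)
      (insert (f y) (generate (BijGroup UNIV) (G \<union> f ` underS r y))))"
  shows "cofinitary_group (generate (BijGroup UNIV) (G \<union> f ` Y))"
proof -
  let ?gen = "generate (BijGroup UNIV)"
  have sub: "subgroup G (BijGroup UNIV)" using G by (simp add: cofinitary_group_def)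
  have bij: "bij h" if "h \<in> cof" "cofinitary_group cof" for h cof
    using that by (simp add: cofinitary_group_def subgroup_BijGroup_iff)
  have "bij h" if "h \<in> G \<union> f ` Y" for h
    using that bij[OF _ G] bij[OF generate.incl step] by auto
  then have "subgroup (?gen (G \<union> f ` Y)) (BijGroup UNIV)"
    by (intro group.generate_is_subgroup[OF group_BijGroup]) auto
  moreover have "h = id \<or> finite {n. h n = n}" if h: "h \<in> ?gen (G \<union> f ` Y)" for h
  proof -
    have "h \<in> G \<or> (\<exists>y\<in>Y. h \<in> ?gen (G \<union> f ` under r y))"
      by (rule generate_linear_union[OF sub r h])
    then show ?thesis
    proof
      assume "h \<in> G"
      then show ?thesis using G by (auto simp: cofinitary_group_def)
    next
      assume "\<exists>y\<in>Y. h \<in> ?gen (G \<union> f ` under r y)"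
      then obtain y where y: "y \<in> Y" "h \<in> ?gen (G \<union> f ` under r y)" by blast
      have "under r y \<subseteq> insert y (underS r y)" by (auto simp: under_def underS_def)
      then have "G \<union> f ` under r y \<subseteq> insert (f y) (?gen (G \<union> f ` underS r y))"
        by (auto intro: generate.incl)
      then have "?gen (G \<union> f ` under r y) \<subseteq> ?gen (insert (f y) (?gen (G \<union> f ` underS r y)))"
        by (rule group.mono_generate[OF group_BijGroup])
      then show ?thesis using y step[OF y(1)] by (auto simp: cofinitary_group_def)
    qed
  qed
  ultimately show ?thesis by (auto simp: cofinitary_group_def)
qed

section \<open>Counting sequences of trees\<close>

lemma countable_sets_lepoll_real: "(UNIV :: 'a :: countable set set) \<lesssim> (UNIV :: real set)"
proof -
  have "inj (\<lambda>A :: 'a set. to_nat ` A)" by (simp add: inj_on_def inj_image_eq_iff)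
  then have "(UNIV :: 'a set set) \<lesssim> (UNIV :: nat set set)" unfolding lepoll_def by blast
  then show ?thesis using nat_sets_eqpoll_reals lepoll_trans2 by blast
qed

lemma tree_sequences_eqpoll_real: "(UNIV :: (nat \<Rightarrow> nat list set) set) \<approx> (UNIV :: real set)"
proof (rule lepoll_antisym)
  have "inj (\<lambda>T. Sigma (UNIV :: nat set) (T :: nat \<Rightarrow> nat list set))"
    by (rule injI) (auto simp: set_eq_iff fun_eq_iff)
  then have "(UNIV :: (nat \<Rightarrow> nat list set) set) \<lesssim> (UNIV :: (nat \<times> nat list) set set)"
    unfolding lepoll_def by blast
  then show "(UNIV :: (nat \<Rightarrow> nat list set) set) \<lesssim> (UNIV :: real set)"
    using countable_sets_lepoll_real by (rule lepoll_trans)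
  have "inj (\<lambda>S (n :: nat). (\<lambda>x :: nat. [x]) ` S)"
    by (rule injI) (auto simp: fun_eq_iff inj_image_eq_iff inj_on_def)
  then have "(UNIV :: nat set set) \<lesssim> (UNIV :: (nat \<Rightarrow> nat list set) set)"
    unfolding lepoll_def by blast
  then show "(UNIV :: real set) \<lesssim> (UNIV :: (nat \<Rightarrow> nat list set) set)"
    using nat_sets_eqpoll_reals eqpoll_sym lepoll_trans1 by blast
qed

lemma nat_functions_lepoll_real: "(A :: (nat \<Rightarrow> nat) set) \<lesssim> (UNIV :: real set)"
proof -
  have "inj_on (\<lambda>f :: nat \<Rightarrow> nat. range (\<lambda>x. (x, f x))) A"
    by (rule inj_onI) (auto simp: fun_eq_iff set_eq_iff image_iff)
  then have "A \<lesssim> (UNIV :: (nat \<times> nat) set set)" unfolding lepoll_def by blast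
  then show ?thesis using countable_sets_lepoll_real by (rule lepoll_trans)
qed

text \<open>A finite \<open>P\<^sub>0\<close> from the smaller group also witnesses membership in
  the ideal of the larger one. A sequence positive for the final group is thus positive at its own
  stage.\<close>

lemma tree_ideal_positive_antimono: "G \<subseteq> H \<Longrightarrow> tree_ideal_positive H \<subseteq> tree_ideal_positive G"
  unfolding tree_ideal_positive_def tree_ideal_def by blast

theorem theorem3p9:
  assumes "MA_sigma_centered"
    and "cofinitary_group G" and "G \<prec> (UNIV :: real set)"
  shows "\<exists>H. tight_cofinitary_group H \<and> G \<subseteq> H \<and> H \<approx> (UNIV :: real set)"
proof -
  let ?gen = "generate (BijGroup UNIV)"
  \<comment> \<open>Sequences index their own stages, so each gets treated. A cardinal order keeps
    all proper initial segments below the continuum.\<close>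
  define r where "r = card_of (UNIV :: (nat \<Rightarrow> nat list set) set)"
  define K where "K f T = ?gen (G \<union> f ` underS r T)" for f T
  \<comment> \<open>Diagonalization is asked only for trees positive at the current stage, so that
    the choice exists for every \<open>T\<close>; \<open>g \<notin> K f T\<close> makes the final
    group large.\<close>
  define P where "P f T g \<longleftrightarrow> cofinitary_group (?gen (insert g (K f T))) \<and> g \<notin> K f T \<and>
    (\<forall>n. T n \<in> tree_ideal_positive (K f T) \<longrightarrow> densely_diagonalizes g (T n))"
    for f T and g :: "nat \<Rightarrow> nat"
  have wo: "well_order r" unfolding r_def by (rule card_of_well_order_on)
  then have lin: "linear_order r" by (simp add: well_order_on_def)
  have "\<exists>f. \<forall>T. P f T (f T)"
  proof (rule dependent_wf_choice)
    show "wf (r - Id)" using wo by (simp add: well_order_on_def)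
    \<comment> \<open>The requirement at \<open>T\<close> depends on earlier choices only, as the
      recursion demands.\<close>
    show "P f T g = P f' T g" if "\<And>S. (S, T) \<in> r - Id \<Longrightarrow> f S = f' S" for f f' T g
    proof -
      have "f ` underS r T = f' ` underS r T"
        using that by (intro image_cong) (auto simp: underS_def)
      then show ?thesis by (simp add: P_def K_def)
    qed
    show "\<exists>g. P f T g" if f: "\<And>S. (S, T) \<in> r - Id \<Longrightarrow> P f S (f S)" for f T
    proof -
      have cof: "cofinitary_group (?gen (insert (f S) (?gen (G \<union> f ` underS r S))))"
        if "S \<in> underS r T" for S
        using f[of S] that by (simp add: P_def K_def underS_def)
      have K: "cofinitary_group (K f T)"
        unfolding K_def by (rule cofinitary_group_linear_union[OF assms(2) lin cof])
      have "underS r T \<prec> (UNIV :: (nat \<Rightarrow> nat list set) set)"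
        unfolding lesspoll_iff_ordLess r_def
        by (intro card_of_underS card_of_Card_order) (simp add: Field_card_of)
      then have "underS r T \<prec> (UNIV :: real set)"
        using tree_sequences_eqpoll_real by (rule lesspoll_eq_trans)
      with image_lepoll have "f ` underS r T \<prec> (UNIV :: real set)" by (rule lesspoll_trans1)
      then have "G \<union> f ` underS r T \<prec> (UNIV :: real set)" using assms(3) by (intro Un_lesspoll_real)
      moreover have "bij h" if "h \<in> G \<union> f ` underS r T" for h
        using K generate.incl[OF that, of "BijGroup UNIV"]
        by (simp add: K_def cofinitary_group_def subgroup_BijGroup_iff)
      ultimately have "K f T \<prec> (UNIV :: real set)"
        unfolding K_def by (intro generate_lesspoll_real)
      then obtain g where "cofinitary_group (?gen (insert g (K f T)))" "g \<notin> K f T"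
        "\<And>n. T n \<in> tree_ideal_positive (K f T) \<Longrightarrow> densely_diagonalizes g (T n)"
        using adjoin_diagonalizing_permutation[OF assms(1) K] by metis
      then show ?thesis unfolding P_def by blast
    qed
  qed
  then obtain f where f: "\<And>T. P f T (f T)" by blast
  define H where "H = ?gen (G \<union> range f)"
  have KH: "K f T \<subseteq> H" for T
    unfolding K_def H_def by (rule group.mono_generate[OF group_BijGroup]) blast
  have fH: "f T \<in> H" for T unfolding H_def by (rule generate.incl) blast
  have "cofinitary_group H"
    unfolding H_def using f
    by (intro cofinitary_group_linear_union[OF assms(2) lin]) (simp add: P_def K_def)
  moreover have "\<exists>g\<in>H. \<forall>n. densely_diagonalizes g (T n)"
    if T: "\<forall>n. T n \<in> tree_ideal_positive H" for T :: "nat \<Rightarrow> nat list set"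
    using T f[of T] fH tree_ideal_positive_antimono[OF KH[of T]] unfolding P_def by blast
  ultimately have "tight_cofinitary_group H" by (simp add: tight_cofinitary_group_def)
  moreover have "G \<subseteq> H" unfolding H_def by (auto intro: generate.incl)
  moreover have "H \<approx> (UNIV :: real set)"
  proof (rule lepoll_antisym)
    show "H \<lesssim> (UNIV :: real set)" by (rule nat_functions_lepoll_real)
    \<comment> \<open>The earlier permutation lies in the group of the later stage, which the later
      one avoids.\<close>
    have neq: "f S \<noteq> f T" if "(S, T) \<in> r" "S \<noteq> T" for S T
    proof -
      have "f S \<in> K f T" unfolding K_def using that by (auto simp: underS_def intro: generate.incl)
      then show ?thesis using f[of T] by (auto simp: P_def)
    qed
    have "inj f"
    proof (rule injI, rule ccontr)
      fix S T assume "f S = f T" "S \<noteq> T"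
      moreover from this(2) have "(S, T) \<in> r \<or> (T, S) \<in> r"
        using lin by (auto simp: linear_order_on_def total_on_def)
      ultimately show False using neq by metis
    qed
    then have "(UNIV :: (nat \<Rightarrow> nat list set) set) \<lesssim> H"
      unfolding lepoll_def using fH by blast
    then show "(UNIV :: real set) \<lesssim> H"
      using tree_sequences_eqpoll_real eqpoll_sym lepoll_trans1 by blast
  qed
  ultimately show ?thesis by blast
qed

end
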